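(* The almost complex structure $\mathbb J$ induced on $\mathcal M$ (on the locus $uv\ne0$) is not integrable.
   Context: Let $x_0,\dots,x_7$ be the standard coordinates on $\mathbb R^8$, with partial derivatives $\partial_i$, and let $e=\sum_i dx_i\otimes dx_i$ and $R=\sum_i x_i^2$. Put $X=-x_1\partial_0+x_0\partial_1-x_3\partial_2+x_2\partial_3-x_5\partial_4+x_4\partial_5-x_7\partial_6+x_6\partial_7$, $Y_1=-x_1\partial_0+x_0\partial_1+x_3\partial_2-x_2\partial_3-x_5\partial_4+x_4\partial_5+x_7\partial_6-x_6\partial_7$, $Y_2=-x_2\partial_0+x_0\partial_2+x_1\partial_3-x_3\partial_1-x_6\partial_4+x_4\partial_6+x_5\partial_7-x_7\partial_5$, $Y_3=-x_3\partial_0+x_0\partial_3+x_2\partial_1-x_1\partial_2-x_7\partial_4+x_4\partial_7+x_6\partial_5-x_5\partial_6$, $\alpha_i=e(Y_i,\cdot)$ and $\hat\alpha_i=\alpha_i/R$. The flow of $Y_1$ is a free circle action on $\mathbb R^8\setminus0$ with quotient $\mathcal C=\mathbb R^+\times\mathbb{CP}^3$; tensors on $\mathcal C$ are identified with their pullbacks to $\mathbb R^8\setminus 0$. The conical $G_2$ structure on $\mathcal C$ has 3-form $\varphi=d(\tfrac13R^3\omega)$, $\omega=d\hat\alpha_1+3\hat\alpha_2\wedge\hat\alpha_3$, and metric $h_2=\tfrac12dR^2+2R\,e-2\alpha_1^2-\alpha_2^2-\alpha_3^2$. The vector field $X$ generates a circle action on $\mathcal C$; its quotient is $Q:\mathcal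 C\to\mathcal M\cong\mathbb R^6\setminus0$, with coordinates $(\mathbf u,\mathbf v)=(u_1,u_2,u_3;v_1,v_2,v_3)$ given by $u_1=x_0^2+x_1^2-x_4^2-x_5^2$, $u_2=2(x_0x_4+x_1x_5)$, $u_3=2(x_0x_5-x_1x_4)$, $v_1=x_2^2+x_3^2-x_6^2-x_7^2$, $v_2=2(x_2x_6+x_3x_7)$, $v_3=2(x_2x_7-x_3x_6)$. Also $u=|\mathbf u|$, $v=|\mathbf v|$, $R=u+v$. Let $N=h_2(X,X)=6uv-2\,\mathbf u\cdot\mathbf v$ and $\Theta_2=\frac2Nh_2(X,\cdot)$. On the locus $uv\ne0$ of $\mathcal M$: the metric $g_2$ is determined by $h_2=Q^*g_2+\tfrac14N\,\Theta_2\otimes\Theta_2$; the symplectic form $\sigma$ is the 2-form to which $X\lrcorner\varphi$ descends; and the almost complex structure $\mathbb J$ is determined by $\sigma(W,Y)=N^{1/2}g_2(\mathbb JW,Y)$ for all tangent vectors $W,Y$. *)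

theory Defs
  imports "HOL-Analysis.Analysis"
begin

section \<open>Differential forms on a normed space\<close>

text \<open>
  A tensor of rank \<open>k\<close> assigns to a point a function of \<open>k\<close> tangent vectors.  The wedge product is
  normalised by \<open>(\<alpha> \<and> \<beta>)(a, b) = \<alpha>(a) \<beta>(b) - \<alpha>(b) \<beta>(a)\<close>, and the exterior derivative
  correspondingly, without combinatorial factors.
\<close>

type_synonym 'a form1 = "'a \<Rightarrow> 'a \<Rightarrow> real"
type_synonym 'a form2 = "'a \<Rightarrow> 'a \<Rightarrow> 'a \<Rightarrow> real"
type_synonym 'a form3 = "'a \<Rightarrow> 'a \<Rightarrow> 'a \<Rightarrow> 'a \<Rightarrow> real"

definition wedge1 :: "'a form1 \<Rightarrow> 'a form1 \<Rightarrow> 'a form2" where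
  "wedge1 \<alpha> \<beta> x a b = \<alpha> x a * \<beta> x b - \<alpha> x b * \<beta> x a"

definition ext_deriv1 :: "'a::real_normed_vector form1 \<Rightarrow> 'a form2" where
  "ext_deriv1 \<alpha> x a b =
     frechet_derivative (\<lambda>y. \<alpha> y b) (at x) a - frechet_derivative (\<lambda>y. \<alpha> y a) (at x) b"

definition ext_deriv2 :: "'a::real_normed_vector form2 \<Rightarrow> 'a form3" where
  "ext_deriv2 \<beta> x a b c =
     frechet_derivative (\<lambda>y. \<beta> y b c) (at x) a
     - frechet_derivative (\<lambda>y. \<beta> y a c) (at x) b
     + frechet_derivative (\<lambda>y. \<beta> y a b) (at x) c"

section \<open>The conical \<open>G\<^sub>2\<close> structure, pulled back to \<open>\<real>\<^sup>8 \<setminus> 0\<close>\<close>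

text \<open>
  The coordinate indices are the eight elements \<open>0, \<dots>, 7\<close> of the numeral type \<open>8\<close>.
\<close>

type_synonym R8 = "real ^ 8"

abbreviation partial :: "8 \<Rightarrow> R8" where
  "partial i \<equiv> axis i 1"

definition X :: "R8 \<Rightarrow> R8" where
  "X x = - (x $ 1) *\<^sub>R partial 0 + (x $ 0) *\<^sub>R partial 1 - (x $ 3) *\<^sub>R partial 2 + (x $ 2) *\<^sub>R partial 3
         - (x $ 5) *\<^sub>R partial 4 + (x $ 4) *\<^sub>R partial 5 - (x $ 7) *\<^sub>R partial 6 + (x $ 6) *\<^sub>R partial 7"

definition Y\<^sub>1 :: "R8 \<Rightarrow> R8" where
  "Y\<^sub>1 x = - (x $ 1) *\<^sub>R partial 0 + (x $ 0) *\<^sub>R partial 1 + (x $ 3) *\<^sub>R partial 2 - (x $ 2) *\<^sub>R partial 3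
          - (x $ 5) *\<^sub>R partial 4 + (x $ 4) *\<^sub>R partial 5 + (x $ 7) *\<^sub>R partial 6 - (x $ 6) *\<^sub>R partial 7"

definition Y\<^sub>2 :: "R8 \<Rightarrow> R8" where
  "Y\<^sub>2 x = - (x $ 2) *\<^sub>R partial 0 + (x $ 0) *\<^sub>R partial 2 + (x $ 1) *\<^sub>R partial 3 - (x $ 3) *\<^sub>R partial 1
          - (x $ 6) *\<^sub>R partial 4 + (x $ 4) *\<^sub>R partial 6 + (x $ 5) *\<^sub>R partial 7 - (x $ 7) *\<^sub>R partial 5"

definition Y\<^sub>3 :: "R8 \<Rightarrow> R8" where
  "Y\<^sub>3 x = - (x $ 3) *\<^sub>R partial 0 + (x $ 0) *\<^sub>R partial 3 + (x $ 2) *\<^sub>R partial 1 - (x $ 1) *\<^sub>R partial 2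
          - (x $ 7) *\<^sub>R partial 4 + (x $ 4) *\<^sub>R partial 7 + (x $ 6) *\<^sub>R partial 5 - (x $ 5) *\<^sub>R partial 6"

definition euc :: "R8 \<Rightarrow> R8 \<Rightarrow> real" where
  "euc a b = (\<Sum>i\<in>UNIV. a $ i * b $ i)"

definition R :: "R8 \<Rightarrow> real" where
  "R x = (\<Sum>i\<in>UNIV. (x $ i)\<^sup>2)"

definition dR :: "R8 form1" where
  "dR x a = frechet_derivative R (at x) a"

definition \<alpha>\<^sub>1 :: "R8 form1" where "\<alpha>\<^sub>1 x a = euc (Y\<^sub>1 x) a"
definition \<alpha>\<^sub>2 :: "R8 form1" where "\<alpha>\<^sub>2 x a = euc (Y\<^sub>2 x) a"
definition \<alpha>\<^sub>3 :: "R8 form1" where "\<alpha>\<^sub>3 x a = euc (Y\<^sub>3 x) a"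

definition hat\<alpha>\<^sub>1 :: "R8 form1" where "hat\<alpha>\<^sub>1 x a = \<alpha>\<^sub>1 x a / R x"
definition hat\<alpha>\<^sub>2 :: "R8 form1" where "hat\<alpha>\<^sub>2 x a = \<alpha>\<^sub>2 x a / R x"
definition hat\<alpha>\<^sub>3 :: "R8 form1" where "hat\<alpha>\<^sub>3 x a = \<alpha>\<^sub>3 x a / R x"

definition \<omega> :: "R8 form2" where
  "\<omega> x a b = ext_deriv1 hat\<alpha>\<^sub>1 x a b + 3 * wedge1 hat\<alpha>\<^sub>2 hat\<alpha>\<^sub>3 x a b"

definition \<phi> :: "R8 form3" where
  "\<phi> = ext_deriv2 (\<lambda>x a b. 1 / 3 * R x ^ 3 * \<omega> x a b)"

definition h\<^sub>2 :: "R8 \<Rightarrow> R8 \<Rightarrow> R8 \<Rightarrow> real" where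
  "h\<^sub>2 x a b = 1 / 2 * dR x a * dR x b + 2 * R x * euc a b
             - 2 * \<alpha>\<^sub>1 x a * \<alpha>\<^sub>1 x b - \<alpha>\<^sub>2 x a * \<alpha>\<^sub>2 x b - \<alpha>\<^sub>3 x a * \<alpha>\<^sub>3 x b"

definition N :: "R8 \<Rightarrow> real" where
  "N x = h\<^sub>2 x (X x) (X x)"

definition \<Theta>\<^sub>2 :: "R8 form1" where
  "\<Theta>\<^sub>2 x a = 2 / N x * h\<^sub>2 x (X x) a"

section \<open>The quotient and the induced tensors\<close>

text \<open>Points of \<open>\<M>\<close> are pairs \<open>(u, v)\<close> of vectors in \<open>\<real>\<^sup>3\<close>.\<close>

type_synonym M = "(real ^ 3) \<times> (real ^ 3)"

definition Q :: "R8 \<Rightarrow> M" where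
  "Q x =
    (vector [(x $ 0)\<^sup>2 + (x $ 1)\<^sup>2 - (x $ 4)\<^sup>2 - (x $ 5)\<^sup>2,
             2 * (x $ 0 * x $ 4 + x $ 1 * x $ 5),
             2 * (x $ 0 * x $ 5 - x $ 1 * x $ 4)],
     vector [(x $ 2)\<^sup>2 + (x $ 3)\<^sup>2 - (x $ 6)\<^sup>2 - (x $ 7)\<^sup>2,
             2 * (x $ 2 * x $ 6 + x $ 3 * x $ 7),
             2 * (x $ 2 * x $ 7 - x $ 3 * x $ 6)])"

definition dQ :: "R8 \<Rightarrow> R8 \<Rightarrow> M" where
  "dQ x a = frechet_derivative Q (at x) a"

definition locus :: "M set" where
  "locus = {(u, v). norm u * norm v \<noteq> 0}"

text \<open>
  The following tensors on \<open>\<M>\<close> are characterised by their pullbacks to \<open>\<real>\<^sup>8 \<setminus> 0\<close>; the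
  defining equations determine them on \<^const>\<open>locus\<close>, where \<^const>\<open>Q\<close> is a surjective
  submersion.  In particular \<open>N\<^sub>M\<close> is \<^const>\<open>N\<close> regarded as a function on \<open>\<M>\<close>.
\<close>

definition N\<^sub>M :: "M \<Rightarrow> real" where
  "N\<^sub>M p = (THE c. \<forall>x. Q x = p \<longrightarrow> N x = c)"

definition g\<^sub>2 :: "M \<Rightarrow> M \<Rightarrow> M \<Rightarrow> real" where
  "g\<^sub>2 p = (THE g. bilinear g \<and>
     (\<forall>x a b. Q x = p \<longrightarrow>
        h\<^sub>2 x a b = g (dQ x a) (dQ x b) + 1 / 4 * N x * \<Theta>\<^sub>2 x a * \<Theta>\<^sub>2 x b))"

definition \<sigma> :: "M form2" where
  "\<sigma> p = (THE s. bilinear s \<and>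
     (\<forall>x a b. Q x = p \<longrightarrow> \<phi> x (X x) a b = s (dQ x a) (dQ x b)))"

definition \<J> :: "M \<Rightarrow> M \<Rightarrow> M" where
  "\<J> p = (THE J. linear J \<and> (\<forall>W Y. \<sigma> p W Y = sqrt (N\<^sub>M p) * g\<^sub>2 p (J W) Y))"

section \<open>Integrability\<close>

text \<open>\<open>C\<^sup>k\<close> and \<open>C\<^sup>\<infinity>\<close> maps on an open subset of a finite-dimensional space.\<close>

primrec Ck_on :: "nat \<Rightarrow> 'a::euclidean_space set \<Rightarrow> ('a \<Rightarrow> 'b::real_normed_vector) \<Rightarrow> bool" where
  "Ck_on 0 S f \<longleftrightarrow> continuous_on S f"
| "Ck_on (Suc k) S f \<longleftrightarrow>
     (\<forall>x\<in>S. f differentiable (at x)) \<and>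
     (\<forall>v. Ck_on k S (\<lambda>x. frechet_derivative f (at x) v))"

definition smooth_on :: "'a::euclidean_space set \<Rightarrow> ('a \<Rightarrow> 'b::real_normed_vector) \<Rightarrow> bool" where
  "smooth_on S f \<longleftrightarrow> (\<forall>k. Ck_on k S f)"

text \<open>
  An almost complex structure \<open>J\<close> on an open subset \<open>S\<close> of a six-dimensional space is integrable if
  it is induced by complex coordinates: every point of \<open>S\<close> has a neighbourhood \<open>U\<close> with a smooth
  chart \<open>\<psi>\<close> onto an open set \<open>V\<close> of \<open>\<complex>\<^sup>3\<close>, with smooth inverse \<open>\<eta>\<close>, whose differential
  intertwines \<open>J\<close> with multiplication by \<open>\<i>\<close>.  Transition maps between such charts are then
  automatically holomorphic.
\<close>

definition integrable_acs_on :: "'a::euclidean_space set \<Rightarrow> ('a \<Rightarrow> 'a \<Rightarrow> 'a) \<Rightarrow> bool" where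
  "integrable_acs_on S J \<longleftrightarrow>
     (\<forall>p\<in>S. \<exists>U V (\<psi> :: 'a \<Rightarrow> complex ^ 3) \<eta>.
        open U \<and> p \<in> U \<and> U \<subseteq> S \<and> open V \<and>
        \<psi> ` U = V \<and> (\<forall>q\<in>U. \<eta> (\<psi> q) = q) \<and>
        smooth_on U \<psi> \<and> smooth_on V \<eta> \<and>
        (\<forall>q\<in>U. \<forall>w. frechet_derivative \<psi> (at q) (J q w)
                   = \<i> *s frechet_derivative \<psi> (at q) w))"

end

theory Submission
  imports Defs
begin

text \<open>
  The map \<^const>\<open>Q\<close> is a pair of Hopf maps, and Fierz identities for the Pauli matrices turn the
  tensors upstairs into explicit \<open>O(3)\<close>-invariant expressions in \<open>(u, v)\<close> for \<open>g\<^sub>2\<close> and \<open>\<sigma>\<close>.  On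
  the symmetric loci \<open>|u| = |v| = 1\<close> and \<open>u \<parallel> v\<close> they give closed formulas for \<open>\<J>\<close> on suitable
  vector fields.  Suppose \<open>\<psi>\<close> is a holomorphic chart near \<open>p = (e, e)\<close>, with \<open>e\<close>, \<open>f\<close> orthonormal.
  Differentiating \<open>d\<psi>(\<J> a) = \<i> d\<psi>(a)\<close> along the four curves through \<open>p\<close> that rotate or rescale
  one of the two vectors gives four linear equations; by the symmetry of the second derivative of
  \<open>\<psi>\<close> the second-order terms cancel, which leaves \<open>(1 - 2 \<i>) d\<psi>(f, 0) = 0\<close>, so \<open>d\<psi>\<close> is not
  injective at \<open>p\<close>.
\<close>

section \<open>Second derivatives and differentials along curves\<close>

lemma has_vector_derivative_along_line:
  fixes f :: "'a :: real_normed_vector \<Rightarrow> 'b :: real_normed_vector"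
  assumes "f differentiable (at (q + s *\<^sub>R a))"
  shows "((\<lambda>t. f (q + t *\<^sub>R a)) has_vector_derivative frechet_derivative f (at (q + s *\<^sub>R a)) a) (at s)"
proof -
  have f: "(f has_derivative frechet_derivative f (at (q + s *\<^sub>R a))) (at (q + s *\<^sub>R a))"
    using assms by (simp add: frechet_derivative_works)
  have "((\<lambda>t. q + t *\<^sub>R a) has_derivative (\<lambda>t. t *\<^sub>R a)) (at s)"
    by (auto intro!: derivative_eq_intros)
  from has_derivative_compose[OF this f] show ?thesis
    unfolding has_vector_derivative_def
    by (simp add: linear_cmul[OF has_derivative_linear[OF f]])
qed

text \<open>The scalar mean value theorem is applied twice: in \<open>s\<close> to the increment
  along \<open>h b\<close>, then in \<open>t\<close> to the first derivative. Pairing with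
  \<open>c\<close> makes the functions real-valued, as an exact mean value fails for
  vectors.\<close>

lemma second_difference_mean_value:
  fixes f :: "'a :: real_normed_vector \<Rightarrow> 'b :: real_inner"
  assumes h: "h > 0"
    and f: "\<And>s t. 0 \<le> s \<Longrightarrow> s \<le> h \<Longrightarrow> 0 \<le> t \<Longrightarrow> t \<le> h \<Longrightarrow>
        f differentiable (at (p + s *\<^sub>R a + t *\<^sub>R b))"
    and F: "\<And>s t. 0 \<le> s \<Longrightarrow> s \<le> h \<Longrightarrow> 0 \<le> t \<Longrightarrow> t \<le> h \<Longrightarrow>
        (\<lambda>q. frechet_derivative f (at q) a) differentiable (at (p + s *\<^sub>R a + t *\<^sub>R b))"
  obtains s t where "0 < s" "s < h" "0 < t" "t < h"
    "(f (p + h *\<^sub>R a + h *\<^sub>R b) - f (p + h *\<^sub>R a) - f (p + h *\<^sub>R b) + f p) \<bullet> c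
      = h\<^sup>2 * (frechet_derivative (\<lambda>q. frechet_derivative f (at q) a)
          (at (p + s *\<^sub>R a + t *\<^sub>R b)) b \<bullet> c)"
proof -
  define F where "F = (\<lambda>q. frechet_derivative f (at q) a)"
  define g where "g = (\<lambda>s. (f (p + h *\<^sub>R b + s *\<^sub>R a) - f (p + s *\<^sub>R a)) \<bullet> c)"
  have "DERIV g s :> (F (p + h *\<^sub>R b + s *\<^sub>R a) - F (p + s *\<^sub>R a)) \<bullet> c" if s: "0 \<le> s" "s \<le> h" for s
  proof -
    have "f differentiable (at (p + h *\<^sub>R b + s *\<^sub>R a))" "f differentiable (at (p + s *\<^sub>R a))"
      using f[of s h] f[of s 0] s h by (simp_all add: ac_simps)
    note * = this[THEN has_vector_derivative_along_line]
    have "((\<lambda>s. (f (p + h *\<^sub>R b + s *\<^sub>R a) - f (p + s *\<^sub>R a)) \<bullet> c) has_vector_derivative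
        (F (p + h *\<^sub>R b + s *\<^sub>R a) - F (p + s *\<^sub>R a)) \<bullet> c) (at s)"
      unfolding F_def
      by (rule bounded_linear.has_vector_derivative[OF bounded_linear_inner_left])
        (intro has_vector_derivative_diff *)
    then show ?thesis by (simp add: g_def has_real_derivative_iff_has_vector_derivative)
  qed
  from MVT2[OF h this] obtain s where s: "0 < s" "s < h"
    and gs: "g h - g 0 = h * ((F (p + h *\<^sub>R b + s *\<^sub>R a) - F (p + s *\<^sub>R a)) \<bullet> c)" by auto
  have "DERIV (\<lambda>t. F (p + s *\<^sub>R a + t *\<^sub>R b) \<bullet> c) t :>
      frechet_derivative F (at (p + s *\<^sub>R a + t *\<^sub>R b)) b \<bullet> c" if t: "0 \<le> t" "t \<le> h" for t
  proof -
    have "F differentiable (at (p + s *\<^sub>R a + t *\<^sub>R b))"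
      using F[of s t] s t by (simp add: F_def)
    from has_vector_derivative_along_line[OF this] show ?thesis
      unfolding has_real_derivative_iff_has_vector_derivative
      by (rule bounded_linear.has_vector_derivative[OF bounded_linear_inner_left])
  qed
  from MVT2[OF h this] obtain t where t: "0 < t" "t < h"
    and Ft: "F (p + s *\<^sub>R a + h *\<^sub>R b) \<bullet> c - F (p + s *\<^sub>R a + 0 *\<^sub>R b) \<bullet> c
      = h * (frechet_derivative F (at (p + s *\<^sub>R a + t *\<^sub>R b)) b \<bullet> c)" by auto
  have "(f (p + h *\<^sub>R a + h *\<^sub>R b) - f (p + h *\<^sub>R a) - f (p + h *\<^sub>R b) + f p) \<bullet> c = g h - g 0"
    by (simp add: g_def inner_simps ac_simps)
  also have "\<dots> = h * (F (p + s *\<^sub>R a + h *\<^sub>R b) \<bullet> c - F (p + s *\<^sub>R a + 0 *\<^sub>R b) \<bullet> c)"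
    unfolding gs by (simp add: inner_simps ac_simps)
  also have "\<dots> = h\<^sup>2 * (frechet_derivative F (at (p + s *\<^sub>R a + t *\<^sub>R b)) b \<bullet> c)"
    unfolding Ft by (simp add: power2_eq_square)
  finally show thesis using s t that unfolding F_def by blast
qed

text \<open>The second difference over a parallelogram does not depend on the order of
  \<open>a\<close> and \<open>b\<close>, while the mean value form can be applied in either order. A
  small parallelogram and continuity at \<open>p\<close> force both values to agree.\<close>

lemma second_derivative_symmetric:
  fixes f :: "'a :: real_normed_vector \<Rightarrow> 'b :: real_inner"
  defines "H \<equiv> \<lambda>x v w. frechet_derivative (\<lambda>q. frechet_derivative f (at q) v) (at x) w"
  assumes U: "open U" "p \<in> U"
    and f: "\<And>q. q \<in> U \<Longrightarrow> f differentiable (at q)"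
    and F: "\<And>q v. q \<in> U \<Longrightarrow> (\<lambda>q. frechet_derivative f (at q) v) differentiable (at q)"
    and H: "\<And>v w. continuous (at p) (\<lambda>x. H x v w)"
  shows "H p a b = H p b a"
proof (rule ccontr)
  assume "H p a b \<noteq> H p b a"
  \<comment> \<open>Testing against the alleged difference itself opens a gap of size
    \<open>c \<bullet> c\<close>, which two errors below \<open>\<epsilon>\<close> cannot
    close.\<close>
  define c where "c = H p a b - H p b a"
  define \<epsilon> where "\<epsilon> = c \<bullet> c / 2"
  have eps: "\<epsilon> > 0" using \<open>H p a b \<noteq> H p b a\<close> by (simp add: \<epsilon>_def c_def)
  have cont: "continuous (at p) (\<lambda>x. H x v w \<bullet> c)" for v w
    by (intro continuous_intros H)
  obtain d1 where d1: "d1 > 0" "\<And>x. dist x p < d1 \<Longrightarrow> dist (H x a b \<bullet> c) (H p a b \<bullet> c) < \<epsilon>"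
    using cont[of a b] eps unfolding continuous_at_eps_delta dist_norm by metis
  obtain d2 where d2: "d2 > 0" "\<And>x. dist x p < d2 \<Longrightarrow> dist (H x b a \<bullet> c) (H p b a \<bullet> c) < \<epsilon>"
    using cont[of b a] eps unfolding continuous_at_eps_delta dist_norm by metis
  obtain d3 where d3: "d3 > 0" "ball p d3 \<subseteq> U" using U openE by blast
  define d where "d = min d1 (min d2 d3)"
  have d: "d > 0" "d \<le> d1" "d \<le> d2" "d \<le> d3" using d1 d2 d3 by (auto simp: d_def)
  \<comment> \<open>The parallelogram with sides \<open>h a\<close>, \<open>h b\<close> must lie in
    the ball of radius \<open>d\<close>; the added 1 covers \<open>a = b = 0\<close> and makes the
    bound strict.\<close>
  define h where "h = d / (norm a + norm b + 1)"
  have pos: "norm a + norm b + 1 > 0" by (simp add: add_nonneg_pos)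
  have h: "h > 0" using d pos by (simp add: h_def)
  have near: "dist (p + s *\<^sub>R a + t *\<^sub>R b) p < d"
    if "0 \<le> s" "s \<le> h" "0 \<le> t" "t \<le> h" for s t
  proof -
    have "dist (p + s *\<^sub>R a + t *\<^sub>R b) p = norm (s *\<^sub>R a + t *\<^sub>R b)"
      by (simp add: dist_norm algebra_simps)
    also have "\<dots> \<le> s * norm a + t * norm b"
      using norm_triangle_ineq[of "s *\<^sub>R a" "t *\<^sub>R b"] that by simp
    also have "\<dots> \<le> h * norm a + h * norm b"
      using that by (intro add_mono mult_right_mono) auto
    also have "\<dots> < h * (norm a + norm b + 1)" using h by (simp add: algebra_simps)
    also have "\<dots> = d" using pos by (simp add: h_def)
    finally show ?thesis .
  qed
  have inU: "p + s *\<^sub>R a + t *\<^sub>R b \<in> U" if "0 \<le> s" "s \<le> h" "0 \<le> t" "t \<le> h" for s t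
    using near[OF that] d(4) d3(2) by (auto simp: dist_commute subset_iff)
  obtain s t where st: "0 < s" "s < h" "0 < t" "t < h"
    and 1: "(f (p + h *\<^sub>R a + h *\<^sub>R b) - f (p + h *\<^sub>R a) - f (p + h *\<^sub>R b) + f p) \<bullet> c
      = h\<^sup>2 * (H (p + s *\<^sub>R a + t *\<^sub>R b) a b \<bullet> c)"
    unfolding H_def
    by (rule second_difference_mean_value[OF h, of f p a b c]) (auto intro: f F inU)
  have inU': "p + t *\<^sub>R b + s *\<^sub>R a \<in> U" if "0 \<le> s" "s \<le> h" "0 \<le> t" "t \<le> h" for s t
    using inU[OF that] by (simp add: ac_simps)
  obtain s' t' where st': "0 < s'" "s' < h" "0 < t'" "t' < h"
    and 2: "(f (p + h *\<^sub>R b + h *\<^sub>R a) - f (p + h *\<^sub>R b) - f (p + h *\<^sub>R a) + f p) \<bullet> c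
      = h\<^sup>2 * (H (p + s' *\<^sub>R b + t' *\<^sub>R a) b a \<bullet> c)"
    unfolding H_def
    by (rule second_difference_mean_value[OF h, of f p b a c]) (auto intro: f F inU')
  have "f (p + h *\<^sub>R b + h *\<^sub>R a) - f (p + h *\<^sub>R b) - f (p + h *\<^sub>R a) + f p
      = f (p + h *\<^sub>R a + h *\<^sub>R b) - f (p + h *\<^sub>R a) - f (p + h *\<^sub>R b) + f p"
    by (simp add: ac_simps)
  with 1 2 have "h\<^sup>2 * (H (p + s *\<^sub>R a + t *\<^sub>R b) a b \<bullet> c) = h\<^sup>2 * (H (p + s' *\<^sub>R b + t' *\<^sub>R a) b a \<bullet> c)"
    by metis
  with h have eq: "H (p + s *\<^sub>R a + t *\<^sub>R b) a b \<bullet> c = H (p + t' *\<^sub>R a + s' *\<^sub>R b) b a \<bullet> c"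
    by (simp add: ac_simps)
  have "dist (H (p + s *\<^sub>R a + t *\<^sub>R b) a b \<bullet> c) (H p a b \<bullet> c) < \<epsilon>"
    using near[of s t] st d(2) by (intro d1(2)) auto
  moreover have "dist (H (p + t' *\<^sub>R a + s' *\<^sub>R b) b a \<bullet> c) (H p b a \<bullet> c) < \<epsilon>"
    using near[of t' s'] st' d(3) by (intro d2(2)) auto
  ultimately have "\<bar>H p a b \<bullet> c - H p b a \<bullet> c\<bar> < 2 * \<epsilon>"
    unfolding eq by (simp add: dist_real_def)
  moreover have "H p a b \<bullet> c - H p b a \<bullet> c = c \<bullet> c" by (simp add: c_def inner_simps)
  ultimately show False by (simp add: \<epsilon>_def)
qed

text \<open>A product rule. Differentiability is assumed for each fixed vector \<open>v\<close>
  only, so the moving vector is expanded in the basis and the rule is applied to each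
  coefficient.\<close>

lemma has_vector_derivative_differential_along_curve:
  fixes f :: "'a :: euclidean_space \<Rightarrow> 'b :: real_normed_vector"
  assumes U: "open U" "\<gamma> 0 \<in> U"
    and f: "\<And>q. q \<in> U \<Longrightarrow> f differentiable (at q)"
    and F: "\<And>v. (\<lambda>q. frechet_derivative f (at q) v) differentiable (at (\<gamma> 0))"
    and \<gamma>: "(\<gamma> has_vector_derivative \<gamma>') (at 0)" and a: "(a has_vector_derivative a') (at 0)"
  shows "((\<lambda>t :: real. frechet_derivative f (at (\<gamma> t)) (a t)) has_vector_derivative
    frechet_derivative (\<lambda>q. frechet_derivative f (at q) (a 0)) (at (\<gamma> 0)) \<gamma>'
      + frechet_derivative f (at (\<gamma> 0)) a') (at 0)"
proof -
  define D where "D q v = frechet_derivative f (at q) v" for q v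
  define K where "K v = frechet_derivative (\<lambda>q. D q v) (at (\<gamma> 0))" for v
  have K: "((\<lambda>q. D q v) has_derivative K v) (at (\<gamma> 0))" for v
    using F unfolding K_def D_def by (simp add: frechet_derivative_works)
  have sum: "D q v = (\<Sum>e\<in>Basis. (v \<bullet> e) *\<^sub>R D q e)" if "q \<in> U" for q v
  proof -
    have "linear (D q)"
      using f[OF that] unfolding D_def by (simp add: linear_frechet_derivative)
    then have "D q (\<Sum>e\<in>Basis. (v \<bullet> e) *\<^sub>R e) = (\<Sum>e\<in>Basis. (v \<bullet> e) *\<^sub>R D q e)"
      by (simp add: linear_sum linear_cmul)
    then show ?thesis by (simp only: euclidean_representation)
  qed
  have "((\<lambda>q. \<Sum>e\<in>Basis. (v \<bullet> e) *\<^sub>R D q e) has_derivative (\<lambda>w. \<Sum>e\<in>Basis. (v \<bullet> e) *\<^sub>R K e w))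
      (at (\<gamma> 0))" for v
    by (intro has_derivative_sum has_derivative_scaleR_right K)
  then have "((\<lambda>q. D q v) has_derivative (\<lambda>w. \<Sum>e\<in>Basis. (v \<bullet> e) *\<^sub>R K e w)) (at (\<gamma> 0))" for v
    by (rule has_derivative_transform_within_open[OF _ U]) (simp add: sum)
  \<comment> \<open>Uniqueness of the derivative makes \<open>K\<close> linear in \<open>v\<close>,
    although its definition treats each \<open>v\<close> separately.\<close>
  then have Ksum: "K v w = (\<Sum>e\<in>Basis. (v \<bullet> e) *\<^sub>R K e w)" for v w
    using has_derivative_unique[OF K] by metis
  have comp: "((\<lambda>t. D (\<gamma> t) e) has_vector_derivative K e \<gamma>') (at 0)" for e
    using has_derivative_compose[OF \<gamma>[unfolded has_vector_derivative_def] K]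
    unfolding has_vector_derivative_def by (simp add: linear_cmul[OF has_derivative_linear[OF K]])
  have ae: "((\<lambda>t. a t \<bullet> e) has_real_derivative a' \<bullet> e) (at 0)" for e
    unfolding has_real_derivative_iff_has_vector_derivative
    by (rule bounded_linear.has_vector_derivative[OF bounded_linear_inner_left a])
  have "((\<lambda>t. \<Sum>e\<in>Basis. (a t \<bullet> e) *\<^sub>R D (\<gamma> t) e) has_vector_derivative
      (\<Sum>e\<in>Basis. (a 0 \<bullet> e) *\<^sub>R K e \<gamma>' + (a' \<bullet> e) *\<^sub>R D (\<gamma> 0) e)) (at 0)"
    by (intro has_vector_derivative_sum has_vector_derivative_scaleR comp ae)
  moreover have "(\<Sum>e\<in>Basis. (a 0 \<bullet> e) *\<^sub>R K e \<gamma>' + (a' \<bullet> e) *\<^sub>R D (\<gamma> 0) e)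
      = K (a 0) \<gamma>' + D (\<gamma> 0) a'"
    by (simp add: sum.distrib Ksum[of "a 0"] sum[OF U(2), of a'])
  ultimately have *: "((\<lambda>t. \<Sum>e\<in>Basis. (a t \<bullet> e) *\<^sub>R D (\<gamma> t) e) has_vector_derivative
      K (a 0) \<gamma>' + D (\<gamma> 0) a') (at 0)" by simp
  have "isCont \<gamma> 0" using has_vector_derivative_continuous[OF \<gamma>] .
  then have "eventually (\<lambda>t. \<gamma> t \<in> U) (nhds 0)"
    using U by (metis (no_types, lifting) continuous_at_open eventually_nhds)
  then obtain S where S: "open S" "0 \<in> S" "\<And>t. t \<in> S \<Longrightarrow> \<gamma> t \<in> U"
    unfolding eventually_nhds by blast
  have "((\<lambda>t. D (\<gamma> t) (a t)) has_vector_derivative K (a 0) \<gamma>' + D (\<gamma> 0) a') (at 0)"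
    by (rule has_vector_derivative_transform_within_open[OF * S(1,2)])
      (use S(3) sum in \<open>simp add: sum[symmetric]\<close>)
  then show ?thesis unfolding D_def K_def .
qed

section \<open>The forms on \<open>\<real>\<^sup>8\<close>\<close>

lemma UNIV_8: "(UNIV :: 8 set) = {0, 1, 2, 3, 4, 5, 6, 7}"
proof -
  have "card {0, 1, 2, 3, 4, 5, 6, 7 :: 8} = CARD(8)" by simp
  then show ?thesis by (metis card_eq_UNIV_imp_eq_UNIV finite)
qed

lemma sum_8: "sum f (UNIV :: 8 set) = f 0 + f 1 + f 2 + f 3 + f 4 + f 5 + f 6 + (f 7 :: real)"
  unfolding UNIV_8 by simp

lemma inner_8: "a \<bullet> b = a $ 0 * b $ 0 + a $ 1 * b $ 1 + a $ 2 * b $ 2 + a $ 3 * b $ 3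
    + a $ 4 * b $ 4 + a $ 5 * b $ 5 + a $ 6 * b $ 6 + a $ 7 * b $ 7" for a b :: R8
  by (simp add: inner_vec_def sum_8)

lemma inner_3: "a \<bullet> b = a $ 1 * b $ 1 + a $ 2 * b $ 2 + a $ 3 * b $ 3" for a b :: "real ^ 3"
  by (simp add: inner_vec_def sum_3)

lemma euc_eq_inner: "euc a b = a \<bullet> b"
  by (simp add: euc_def inner_vec_def)

lemma R_eq_inner: "R x = x \<bullet> x"
  by (simp add: R_def inner_vec_def power2_eq_square)

lemma R_eq_0_iff: "R x = 0 \<longleftrightarrow> x = 0"
  by (simp add: R_eq_inner)

lemma X_coords:
  "X x $ 0 = - x $ 1" "X x $ 1 = x $ 0" "X x $ 2 = - x $ 3" "X x $ 3 = x $ 2"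
  "X x $ 4 = - x $ 5" "X x $ 5 = x $ 4" "X x $ 6 = - x $ 7" "X x $ 7 = x $ 6"
  by (simp_all add: X_def axis_def)

lemma Y\<^sub>1_coords:
  "Y\<^sub>1 x $ 0 = - x $ 1" "Y\<^sub>1 x $ 1 = x $ 0" "Y\<^sub>1 x $ 2 = x $ 3" "Y\<^sub>1 x $ 3 = - x $ 2"
  "Y\<^sub>1 x $ 4 = - x $ 5" "Y\<^sub>1 x $ 5 = x $ 4" "Y\<^sub>1 x $ 6 = x $ 7" "Y\<^sub>1 x $ 7 = - x $ 6"
  by (simp_all add: Y\<^sub>1_def axis_def)

lemma Y\<^sub>2_coords:
  "Y\<^sub>2 x $ 0 = - x $ 2" "Y\<^sub>2 x $ 1 = - x $ 3" "Y\<^sub>2 x $ 2 = x $ 0" "Y\<^sub>2 x $ 3 = x $ 1"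
  "Y\<^sub>2 x $ 4 = - x $ 6" "Y\<^sub>2 x $ 5 = - x $ 7" "Y\<^sub>2 x $ 6 = x $ 4" "Y\<^sub>2 x $ 7 = x $ 5"
  by (simp_all add: Y\<^sub>2_def axis_def)

lemma Y\<^sub>3_coords:
  "Y\<^sub>3 x $ 0 = - x $ 3" "Y\<^sub>3 x $ 1 = x $ 2" "Y\<^sub>3 x $ 2 = - x $ 1" "Y\<^sub>3 x $ 3 = x $ 0"
  "Y\<^sub>3 x $ 4 = - x $ 7" "Y\<^sub>3 x $ 5 = x $ 6" "Y\<^sub>3 x $ 6 = - x $ 5" "Y\<^sub>3 x $ 7 = x $ 4"
  by (simp_all add: Y\<^sub>3_def axis_def)

lemmas Y_coords = Y\<^sub>1_coords Y\<^sub>2_coords Y\<^sub>3_coords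

lemmas \<alpha>_eq_inner = \<alpha>\<^sub>1_def[unfolded euc_eq_inner] \<alpha>\<^sub>2_def[unfolded euc_eq_inner]
  \<alpha>\<^sub>3_def[unfolded euc_eq_inner]

lemmas \<alpha>_coords = \<alpha>_eq_inner inner_8 Y_coords

text \<open>The fields are linear in the point, with skew matrices, so each \<alpha> is a skew
  bilinear form in point and vector. Evaluated at two tangent vectors it is half of the constant
  2-form d\<alpha>.\<close>

lemma \<alpha>_antisym: "\<alpha>\<^sub>1 a b = - \<alpha>\<^sub>1 b a" "\<alpha>\<^sub>2 a b = - \<alpha>\<^sub>2 b a" "\<alpha>\<^sub>3 a b = - \<alpha>\<^sub>3 b a"
  by (simp_all add: \<alpha>_coords)

lemma \<alpha>_has_derivative [derivative_intros]:
  "((\<lambda>y. \<alpha>\<^sub>1 y b) has_derivative (\<lambda>a. \<alpha>\<^sub>1 a b)) (at x within S)"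
  "((\<lambda>y. \<alpha>\<^sub>2 y b) has_derivative (\<lambda>a. \<alpha>\<^sub>2 a b)) (at x within S)"
  "((\<lambda>y. \<alpha>\<^sub>3 y b) has_derivative (\<lambda>a. \<alpha>\<^sub>3 a b)) (at x within S)"
  by (auto intro!: linear_imp_has_derivative linearI simp: \<alpha>_coords algebra_simps)

lemma R_has_derivative [derivative_intros]:
  "(R has_derivative (\<lambda>a. 2 * (x \<bullet> a))) (at x within S)"
  unfolding R_eq_inner[abs_def] by (auto intro!: derivative_eq_intros simp: inner_commute)

lemma dR_eq: "dR x a = 2 * (x \<bullet> a)"
  unfolding dR_def by (simp add: frechet_derivative_at[OF R_has_derivative, symmetric])

lemma ext_deriv1_hat\<alpha>\<^sub>1:
  assumes "x \<noteq> 0"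
  shows "R x ^ 2 * ext_deriv1 hat\<alpha>\<^sub>1 x a b
    = 2 * R x * \<alpha>\<^sub>1 a b - 2 * (x \<bullet> a) * \<alpha>\<^sub>1 x b + 2 * (x \<bullet> b) * \<alpha>\<^sub>1 x a"
proof -
  have R0: "R x \<noteq> 0" using assms by (simp add: R_eq_0_iff)
  have "((\<lambda>y. hat\<alpha>\<^sub>1 y b) has_derivative
      (\<lambda>a. (\<alpha>\<^sub>1 a b * R x - \<alpha>\<^sub>1 x b * (2 * (x \<bullet> a))) / (R x * R x))) (at x)" for b
    unfolding hat\<alpha>\<^sub>1_def[abs_def] using R0 by (auto intro!: derivative_eq_intros)
  then have "frechet_derivative (\<lambda>y. hat\<alpha>\<^sub>1 y b) (at x)
      = (\<lambda>a. (\<alpha>\<^sub>1 a b * R x - \<alpha>\<^sub>1 x b * (2 * (x \<bullet> a))) / (R x * R x))" for b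
    by (rule frechet_derivative_at[symmetric])
  then show ?thesis
    using R0 by (simp add: ext_deriv1_def \<alpha>_antisym(1)[of b a] field_simps power2_eq_square)
qed

text \<open>
  The form \<open>\<phi>\<close> is the exterior derivative of a polynomial 2-form: the powers of \<^const>\<open>R\<close> clear all
  denominators.  The identity also holds at the origin, where \<^const>\<open>R\<close> vanishes and kills the junk
  value of \<^const>\<open>ext_deriv1\<close>.
\<close>

definition pot :: "R8 form2" where
  "pot x a b = 2 / 3 * R x ^ 2 * \<alpha>\<^sub>1 a b
     - 2 / 3 * R x * ((x \<bullet> a) * \<alpha>\<^sub>1 x b - (x \<bullet> b) * \<alpha>\<^sub>1 x a)
     + R x * (\<alpha>\<^sub>2 x a * \<alpha>\<^sub>3 x b - \<alpha>\<^sub>2 x b * \<alpha>\<^sub>3 x a)"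

lemma pot_eq: "1 / 3 * R x ^ 3 * \<omega> x a b = pot x a b"
proof (cases "x = 0")
  case True
  then show ?thesis by (simp add: pot_def R_eq_inner)
next
  case False
  then have R0: "R x \<noteq> 0" by (simp add: R_eq_0_iff)
  have w: "R x ^ 2 * wedge1 hat\<alpha>\<^sub>2 hat\<alpha>\<^sub>3 x a b = \<alpha>\<^sub>2 x a * \<alpha>\<^sub>3 x b - \<alpha>\<^sub>2 x b * \<alpha>\<^sub>3 x a"
    using R0 by (simp add: wedge1_def hat\<alpha>\<^sub>2_def hat\<alpha>\<^sub>3_def field_simps power2_eq_square)
  have "1 / 3 * R x ^ 3 * \<omega> x a b = 1 / 3 * R x * (R x ^ 2 * ext_deriv1 hat\<alpha>\<^sub>1 x a b
      + 3 * (R x ^ 2 * wedge1 hat\<alpha>\<^sub>2 hat\<alpha>\<^sub>3 x a b))"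
    by (simp add: \<omega>_def algebra_simps power2_eq_square power3_eq_cube)
  then show ?thesis
    unfolding w ext_deriv1_hat\<alpha>\<^sub>1[OF False]
    by (simp add: pot_def algebra_simps power2_eq_square)
qed

text \<open>In the alternating sum of the derivatives of \<open>pot\<close>, the terms with two
  factors of type \<open>x \<bullet> a\<close> and those with \<open>a \<bullet> b\<close>
  cancel.\<close>

lemma \<phi>_eq:
  "\<phi> x a b c =
     4 * R x * ((x \<bullet> a) * \<alpha>\<^sub>1 b c - (x \<bullet> b) * \<alpha>\<^sub>1 a c + (x \<bullet> c) * \<alpha>\<^sub>1 a b)
     + 2 * (x \<bullet> a) * (\<alpha>\<^sub>2 x b * \<alpha>\<^sub>3 x c - \<alpha>\<^sub>2 x c * \<alpha>\<^sub>3 x b)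
     - 2 * (x \<bullet> b) * (\<alpha>\<^sub>2 x a * \<alpha>\<^sub>3 x c - \<alpha>\<^sub>2 x c * \<alpha>\<^sub>3 x a)
     + 2 * (x \<bullet> c) * (\<alpha>\<^sub>2 x a * \<alpha>\<^sub>3 x b - \<alpha>\<^sub>2 x b * \<alpha>\<^sub>3 x a)
     + 2 * R x * (\<alpha>\<^sub>2 a b * \<alpha>\<^sub>3 x c - \<alpha>\<^sub>2 a c * \<alpha>\<^sub>3 x b + \<alpha>\<^sub>2 b c * \<alpha>\<^sub>3 x a
         - \<alpha>\<^sub>2 x a * \<alpha>\<^sub>3 b c + \<alpha>\<^sub>2 x b * \<alpha>\<^sub>3 a c - \<alpha>\<^sub>2 x c * \<alpha>\<^sub>3 a b)"
proof -
  have "((\<lambda>y. pot y b c) has_derivative (\<lambda>a.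
      8 / 3 * R x * (x \<bullet> a) * \<alpha>\<^sub>1 b c
      - 4 / 3 * (x \<bullet> a) * ((x \<bullet> b) * \<alpha>\<^sub>1 x c - (x \<bullet> c) * \<alpha>\<^sub>1 x b)
      - 2 / 3 * R x * ((a \<bullet> b) * \<alpha>\<^sub>1 x c + (x \<bullet> b) * \<alpha>\<^sub>1 a c - (a \<bullet> c) * \<alpha>\<^sub>1 x b - (x \<bullet> c) * \<alpha>\<^sub>1 a b)
      + 2 * (x \<bullet> a) * (\<alpha>\<^sub>2 x b * \<alpha>\<^sub>3 x c - \<alpha>\<^sub>2 x c * \<alpha>\<^sub>3 x b)
      + R x * (\<alpha>\<^sub>2 a b * \<alpha>\<^sub>3 x c + \<alpha>\<^sub>2 x b * \<alpha>\<^sub>3 a c - \<alpha>\<^sub>2 a c * \<alpha>\<^sub>3 x b - \<alpha>\<^sub>2 x c * \<alpha>\<^sub>3 a b)))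
      (at x)" for b c
    unfolding pot_def[abs_def]
    by (auto intro!: derivative_eq_intros simp: fun_eq_iff field_simps)
  note D = frechet_derivative_at[OF this, symmetric]
  show ?thesis
    unfolding \<phi>_def ext_deriv2_def pot_eq D
    by (simp add: \<alpha>_antisym[of b a] \<alpha>_antisym[of c a] \<alpha>_antisym[of c b] inner_commute[of b a]
      inner_commute[of c a] inner_commute[of c b] algebra_simps)
qed

section \<open>Hopf maps and Fierz identities\<close>

text \<open>The polarisation of the quadratic map: \<open>Qb x x = Q x\<close>.\<close>

definition Qb :: "R8 \<Rightarrow> R8 \<Rightarrow> M" where
  "Qb x a =
    (vector [x $ 0 * a $ 0 + x $ 1 * a $ 1 - x $ 4 * a $ 4 - x $ 5 * a $ 5,
             x $ 0 * a $ 4 + a $ 0 * x $ 4 + x $ 1 * a $ 5 + a $ 1 * x $ 5,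
             x $ 0 * a $ 5 + a $ 0 * x $ 5 - x $ 1 * a $ 4 - a $ 1 * x $ 4],
     vector [x $ 2 * a $ 2 + x $ 3 * a $ 3 - x $ 6 * a $ 6 - x $ 7 * a $ 7,
             x $ 2 * a $ 6 + a $ 2 * x $ 6 + x $ 3 * a $ 7 + a $ 3 * x $ 7,
             x $ 2 * a $ 7 + a $ 2 * x $ 7 - x $ 3 * a $ 6 - a $ 3 * x $ 6])"

lemma vector_3_eq: "vector [a, b, c] = a *\<^sub>R axis 1 1 + b *\<^sub>R axis 2 1 + c *\<^sub>R (axis 3 1 :: real ^ 3)"
  by (simp add: vec_eq_iff forall_3 axis_def)

lemma Q_has_derivative: "(Q has_derivative (\<lambda>a. 2 *\<^sub>R Qb x a)) (at x)"
proof -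
  have *: "((\<lambda>y :: R8. y $ i) has_derivative (\<lambda>y. y $ i)) (at x)" for i
    by (rule bounded_linear_imp_has_derivative[OF bounded_linear_vec_nth])
  show ?thesis
    unfolding Q_def[abs_def] Qb_def vector_3_eq
    by (rule derivative_eq_intros * refl)+
      (auto simp: fun_eq_iff vec_eq_iff forall_3 axis_def algebra_simps power2_eq_square)
qed

lemma dQ_eq: "dQ x a = 2 *\<^sub>R Qb x a"
  unfolding dQ_def by (simp add: frechet_derivative_at[OF Q_has_derivative, symmetric])

lemma linear_dQ: "linear (dQ x)"
  unfolding dQ_def
  using has_derivative_linear[OF Q_has_derivative] frechet_derivative_at[OF Q_has_derivative] by metis

text \<open>
  Under \<open>\<real>\<^sup>8 = \<complex>\<^sup>2 \<oplus> \<complex>\<^sup>2\<close> with \<open>z = (x\<^sub>0 + \<i> x\<^sub>1, x\<^sub>4 + \<i> x\<^sub>5)\<close> and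
  \<open>w = (x\<^sub>2 + \<i> x\<^sub>3, x\<^sub>6 + \<i> x\<^sub>7)\<close>, the map \<^const>\<open>Q\<close> is a pair of Hopf maps.  The functions
  below are \<open>Re \<langle>z, a\<rangle>\<close> and \<open>Im \<langle>z, a\<rangle>\<close>, and the same for \<open>w\<close>.
\<close>

definition z_inner :: "R8 \<Rightarrow> R8 \<Rightarrow> real" where
  "z_inner x a = x $ 0 * a $ 0 + x $ 1 * a $ 1 + x $ 4 * a $ 4 + x $ 5 * a $ 5"

definition w_inner :: "R8 \<Rightarrow> R8 \<Rightarrow> real" where
  "w_inner x a = x $ 2 * a $ 2 + x $ 3 * a $ 3 + x $ 6 * a $ 6 + x $ 7 * a $ 7"

definition z_rot :: "R8 \<Rightarrow> R8 \<Rightarrow> real" where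
  "z_rot x a = x $ 0 * a $ 1 - x $ 1 * a $ 0 + x $ 4 * a $ 5 - x $ 5 * a $ 4"

definition w_rot :: "R8 \<Rightarrow> R8 \<Rightarrow> real" where
  "w_rot x a = x $ 2 * a $ 3 - x $ 3 * a $ 2 + x $ 6 * a $ 7 - x $ 7 * a $ 6"

lemmas zw_defs = z_inner_def w_inner_def z_rot_def w_rot_def

lemma inner_split: "x \<bullet> a = z_inner x a + w_inner x a"
  by (simp add: zw_defs inner_8)

lemma \<alpha>\<^sub>1_split: "\<alpha>\<^sub>1 x a = z_rot x a - w_rot x a"
  by (simp add: zw_defs \<alpha>_coords)

lemma R_split: "R x = z_inner x x + w_inner x x"
  by (simp add: R_eq_inner inner_split)

lemma zw_inner_nonneg: "0 \<le> z_inner x x" "0 \<le> w_inner x x"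
  by (simp_all add: zw_defs)

lemma Q_dQ_coords:
  "fst (Q x) $ 1 = (x $ 0)\<^sup>2 + (x $ 1)\<^sup>2 - (x $ 4)\<^sup>2 - (x $ 5)\<^sup>2"
  "fst (Q x) $ 2 = 2 * (x $ 0 * x $ 4 + x $ 1 * x $ 5)"
  "fst (Q x) $ 3 = 2 * (x $ 0 * x $ 5 - x $ 1 * x $ 4)"
  "snd (Q x) $ 1 = (x $ 2)\<^sup>2 + (x $ 3)\<^sup>2 - (x $ 6)\<^sup>2 - (x $ 7)\<^sup>2"
  "snd (Q x) $ 2 = 2 * (x $ 2 * x $ 6 + x $ 3 * x $ 7)"
  "snd (Q x) $ 3 = 2 * (x $ 2 * x $ 7 - x $ 3 * x $ 6)"
  "fst (dQ x a) $ 1 = 2 * (x $ 0 * a $ 0 + x $ 1 * a $ 1 - x $ 4 * a $ 4 - x $ 5 * a $ 5)"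
  "fst (dQ x a) $ 2 = 2 * (x $ 0 * a $ 4 + a $ 0 * x $ 4 + x $ 1 * a $ 5 + a $ 1 * x $ 5)"
  "fst (dQ x a) $ 3 = 2 * (x $ 0 * a $ 5 + a $ 0 * x $ 5 - x $ 1 * a $ 4 - a $ 1 * x $ 4)"
  "snd (dQ x a) $ 1 = 2 * (x $ 2 * a $ 2 + x $ 3 * a $ 3 - x $ 6 * a $ 6 - x $ 7 * a $ 7)"
  "snd (dQ x a) $ 2 = 2 * (x $ 2 * a $ 6 + a $ 2 * x $ 6 + x $ 3 * a $ 7 + a $ 3 * x $ 7)"
  "snd (dQ x a) $ 3 = 2 * (x $ 2 * a $ 7 + a $ 2 * x $ 7 - x $ 3 * a $ 6 - a $ 3 * x $ 6)"
  by (simp_all add: Q_def dQ_eq Qb_def)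

lemma norm_Q: "norm (fst (Q x)) = z_inner x x" "norm (snd (Q x)) = w_inner x x"
proof -
  have "fst (Q x) \<bullet> fst (Q x) = (z_inner x x)\<^sup>2" "snd (Q x) \<bullet> snd (Q x) = (w_inner x x)\<^sup>2"
    by (simp_all add: inner_3 Q_dQ_coords zw_defs algebra_simps power2_eq_square)
  then show "norm (fst (Q x)) = z_inner x x" "norm (snd (Q x)) = w_inner x x"
    by (simp_all add: norm_eq_sqrt_inner zw_inner_nonneg)
qed

lemma Q_inner_dQ:
  "fst (Q x) \<bullet> fst (dQ x a) = 2 * z_inner x x * z_inner x a"
  "snd (Q x) \<bullet> snd (dQ x a) = 2 * w_inner x x * w_inner x a"
  by (simp_all add: inner_3 Q_dQ_coords zw_defs algebra_simps power2_eq_square)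

text \<open>On vectors orthogonal to the fibre the Hopf map is a conformal submersion; the
  subtracted product removes the component along \<i>z or \<i>w, the fibre direction.\<close>

lemma dQ_inner_dQ:
  "fst (dQ x a) \<bullet> fst (dQ x b) = 4 * (z_inner x x * z_inner a b - z_rot x a * z_rot x b)"
  "snd (dQ x a) \<bullet> snd (dQ x b) = 4 * (w_inner x x * w_inner a b - w_rot x a * w_rot x b)"
  by (simp_all add: inner_3 Q_dQ_coords zw_defs algebra_simps power2_eq_square)

text \<open>
  With the Pauli matrices \<open>s\<^sub>j\<close> ordered so that the Hopf map is \<open>z \<mapsto> (z\<^sup>* s\<^sub>j z)\<^sub>j\<close>, these are the
  real and imaginary parts of \<open>z\<^sup>* w\<close> and of the vector \<open>(z\<^sup>* s\<^sub>j w)\<^sub>j\<close>.  They enter because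
  \<open>\<alpha>\<^sub>2 + \<i> \<alpha>\<^sub>3 = z\<^sup>* dw - (dz)\<^sup>* w\<close>.
\<close>

definition zw_re :: "R8 \<Rightarrow> real" where
  "zw_re x = x $ 0 * x $ 2 + x $ 1 * x $ 3 + x $ 4 * x $ 6 + x $ 5 * x $ 7"

definition zw_im :: "R8 \<Rightarrow> real" where
  "zw_im x = x $ 0 * x $ 3 - x $ 1 * x $ 2 + x $ 4 * x $ 7 - x $ 5 * x $ 6"

definition pauli_re :: "R8 \<Rightarrow> real ^ 3" where
  "pauli_re x = vector [x $ 0 * x $ 2 + x $ 1 * x $ 3 - x $ 4 * x $ 6 - x $ 5 * x $ 7,
     x $ 0 * x $ 6 + x $ 1 * x $ 7 + x $ 4 * x $ 2 + x $ 5 * x $ 3,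
     x $ 0 * x $ 7 - x $ 1 * x $ 6 - x $ 4 * x $ 3 + x $ 5 * x $ 2]"

definition pauli_im :: "R8 \<Rightarrow> real ^ 3" where
  "pauli_im x = vector [x $ 0 * x $ 3 - x $ 1 * x $ 2 - x $ 4 * x $ 7 + x $ 5 * x $ 6,
     x $ 0 * x $ 7 - x $ 1 * x $ 6 + x $ 4 * x $ 3 - x $ 5 * x $ 2,
     - x $ 0 * x $ 6 - x $ 1 * x $ 7 + x $ 4 * x $ 2 + x $ 5 * x $ 3]"

lemmas pauli_defs = zw_re_def zw_im_def pauli_re_def pauli_im_def

text \<open>Half of |u| dv - |v| du. Paired with the Pauli vectors it gives the part of |u| |v|
  \<open>\<alpha>\<^sub>2\<close> and |u| |v| \<open>\<alpha>\<^sub>3\<close> that comes from the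
  base.\<close>

definition skew :: "M \<Rightarrow> M \<Rightarrow> real ^ 3" where
  "skew p a = (1 / 2) *\<^sub>R (norm (fst p) *\<^sub>R snd a - norm (snd p) *\<^sub>R fst a)"

text \<open>Completeness of the Pauli matrices: summing over j, the derivative of w* s_j w times z*
  s_j w yields 2 |w|^2 z* dw, corrected by the phase component Im(w* dw) times z* w; likewise for z.
  The right-hand sides hold the real and imaginary parts of z* dw and (dz)* w.\<close>

lemma dQ_inner_pauli:
  "snd (dQ x a) \<bullet> pauli_re x - 2 * w_rot x a * zw_im x
     = 2 * w_inner x x * (x $ 0 * a $ 2 + x $ 1 * a $ 3 + x $ 4 * a $ 6 + x $ 5 * a $ 7)"
  "fst (dQ x a) \<bullet> pauli_re x + 2 * z_rot x a * zw_im x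
     = 2 * z_inner x x * (a $ 0 * x $ 2 + a $ 1 * x $ 3 + a $ 4 * x $ 6 + a $ 5 * x $ 7)"
  "snd (dQ x a) \<bullet> pauli_im x + 2 * w_rot x a * zw_re x
     = 2 * w_inner x x * (x $ 0 * a $ 3 - x $ 1 * a $ 2 + x $ 4 * a $ 7 - x $ 5 * a $ 6)"
  "fst (dQ x a) \<bullet> pauli_im x - 2 * z_rot x a * zw_re x
     = 2 * z_inner x x * (a $ 0 * x $ 3 - a $ 1 * x $ 2 + a $ 4 * x $ 7 - a $ 5 * x $ 6)"
  by (simp_all add: inner_3 Q_dQ_coords zw_defs pauli_defs algebra_simps)

text \<open>The difference of z* dw and (dz)* w splits into a part seen by \<open>dQ\<close> and a
  phase part. The factor \<open>k\<close> is |u| |v| times the later \<open>conn\<close>.\<close>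

lemma \<alpha>\<^sub>2_\<alpha>\<^sub>3_pauli:
  fixes x a
  defines "k \<equiv> w_inner x x * z_rot x a + z_inner x x * w_rot x a"
  shows "z_inner x x * w_inner x x * \<alpha>\<^sub>2 x a
      = skew (Q x) (dQ x a) \<bullet> pauli_re x - k * zw_im x"
    and "z_inner x x * w_inner x x * \<alpha>\<^sub>3 x a
      = skew (Q x) (dQ x a) \<bullet> pauli_im x + k * zw_re x"
proof -
  have 2: "\<alpha>\<^sub>2 x a = (x $ 0 * a $ 2 + x $ 1 * a $ 3 + x $ 4 * a $ 6 + x $ 5 * a $ 7)
      - (a $ 0 * x $ 2 + a $ 1 * x $ 3 + a $ 4 * x $ 6 + a $ 5 * x $ 7)"
    and 3: "\<alpha>\<^sub>3 x a = (x $ 0 * a $ 3 - x $ 1 * a $ 2 + x $ 4 * a $ 7 - x $ 5 * a $ 6)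
      - (a $ 0 * x $ 3 - a $ 1 * x $ 2 + a $ 4 * x $ 7 - a $ 5 * x $ 6)"
    by (simp_all add: \<alpha>_coords)
  show "z_inner x x * w_inner x x * \<alpha>\<^sub>2 x a
      = skew (Q x) (dQ x a) \<bullet> pauli_re x - k * zw_im x"
    using dQ_inner_pauli(1,2)[of x a] unfolding 2 k_def skew_def norm_Q inner_simps
    by simp algebra
  show "z_inner x x * w_inner x x * \<alpha>\<^sub>3 x a
      = skew (Q x) (dQ x a) \<bullet> pauli_im x + k * zw_re x"
    using dQ_inner_pauli(3,4)[of x a] unfolding 3 k_def skew_def norm_Q inner_simps
    by simp algebra
qed

text \<open>A change of phase of z or w multiplies z* w and all z* s_j w by one common phase. The
  quadratic combinations in this and the following Fierz lemmas are invariant under it, hence are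
  functions of (u, v).\<close>

lemma fierz_scalar: "2 * ((zw_re x)\<^sup>2 + (zw_im x)\<^sup>2)
    = z_inner x x * w_inner x x + fst (Q x) \<bullet> snd (Q x)"
  by (simp add: inner_3 Q_dQ_coords zw_defs pauli_defs algebra_simps power2_eq_square)

lemma fierz_vector: "2 * (zw_re x * (n \<bullet> pauli_im x) - zw_im x * (n \<bullet> pauli_re x))
    = - (n \<bullet> cross3 (fst (Q x)) (snd (Q x)))"
  by (simp add: inner_3 Q_dQ_coords cross3_def pauli_defs algebra_simps power2_eq_square)

lemma fierz_entries:
  fixes x
  defines "d \<equiv> z_inner x x * w_inner x x - fst (Q x) \<bullet> snd (Q x)"
    and "E \<equiv> \<lambda>i j. 2 * (pauli_re x $ i * pauli_re x $ j + pauli_im x $ i * pauli_im x $ j)"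
    and "F \<equiv> \<lambda>i j. fst (Q x) $ i * snd (Q x) $ j + fst (Q x) $ j * snd (Q x) $ i"
  shows "E 1 1 = d + F 1 1" "E 2 2 = d + F 2 2" "E 3 3 = d + F 3 3"
    "E 1 2 = F 1 2" "E 1 3 = F 1 3" "E 2 3 = F 2 3"
  by (simp_all add: d_def E_def F_def inner_3 Q_dQ_coords zw_defs pauli_defs algebra_simps
    power2_eq_square)

lemma fierz_tensor:
  "2 * ((m \<bullet> pauli_re x) * (n \<bullet> pauli_re x) + (m \<bullet> pauli_im x) * (n \<bullet> pauli_im x))
    = (z_inner x x * w_inner x x - fst (Q x) \<bullet> snd (Q x)) * (m \<bullet> n)
      + (m \<bullet> fst (Q x)) * (n \<bullet> snd (Q x)) + (n \<bullet> fst (Q x)) * (m \<bullet> snd (Q x))"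
  (is "_ = ?d * _ + _ + _")
proof -
  \<comment> \<open>A symmetric tensor is fixed by its six entries. With the entries as atoms only a
    linear combination of them remains, instead of a polynomial in the eight coordinates.\<close>
  have "2 * ((m \<bullet> p) * (n \<bullet> p) + (m \<bullet> q) * (n \<bullet> q))
      = d * (m \<bullet> n) + (m \<bullet> U) * (n \<bullet> V) + (n \<bullet> U) * (m \<bullet> V)"
    if "2 * (p $ 1 * p $ 1 + q $ 1 * q $ 1) = d + (U $ 1 * V $ 1 + U $ 1 * V $ 1)"
      "2 * (p $ 2 * p $ 2 + q $ 2 * q $ 2) = d + (U $ 2 * V $ 2 + U $ 2 * V $ 2)"
      "2 * (p $ 3 * p $ 3 + q $ 3 * q $ 3) = d + (U $ 3 * V $ 3 + U $ 3 * V $ 3)"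
      "2 * (p $ 1 * p $ 2 + q $ 1 * q $ 2) = U $ 1 * V $ 2 + U $ 2 * V $ 1"
      "2 * (p $ 1 * p $ 3 + q $ 1 * q $ 3) = U $ 1 * V $ 3 + U $ 3 * V $ 1"
      "2 * (p $ 2 * p $ 3 + q $ 2 * q $ 3) = U $ 2 * V $ 3 + U $ 3 * V $ 2"
    for d and p q U V :: "real ^ 3"
    using that unfolding inner_3 by algebra
  from this[OF fierz_entries] show ?thesis .
qed

section \<open>The metric and the symplectic form in the coordinates \<open>(u, v)\<close>\<close>

definition N_form :: "M \<Rightarrow> real" where
  "N_form p = 6 * norm (fst p) * norm (snd p) - 2 * (fst p \<bullet> snd p)"

definition d_norm1 :: "M \<Rightarrow> M \<Rightarrow> real" where
  "d_norm1 p a = (fst p \<bullet> fst a) / norm (fst p)"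

definition d_norm2 :: "M \<Rightarrow> M \<Rightarrow> real" where
  "d_norm2 p a = (snd p \<bullet> snd a) / norm (snd p)"

text \<open>The base part of \<open>h\<^sub>2 x (X x)\<close>; the cross product comes from
  \<open>fierz_vector\<close>.\<close>

definition twist :: "M \<Rightarrow> M \<Rightarrow> real" where
  "twist p a = (skew p a \<bullet> cross3 (fst p) (snd p)) / (norm (fst p) * norm (snd p))"

definition h_base :: "M \<Rightarrow> M \<Rightarrow> M \<Rightarrow> real" where
  "h_base p a b =
     (d_norm1 p a + d_norm2 p a) * (d_norm1 p b + d_norm2 p b) / 2
     + (norm (fst p) + norm (snd p)) / 2
       * ((fst a \<bullet> fst b) / norm (fst p) + (snd a \<bullet> snd b) / norm (snd p))
     - ((norm (fst p) * norm (snd p) - fst p \<bullet> snd p) * (skew p a \<bullet> skew p b)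
        + (skew p a \<bullet> fst p) * (skew p b \<bullet> snd p) + (skew p b \<bullet> fst p) * (skew p a \<bullet> snd p))
       / (2 * (norm (fst p))\<^sup>2 * (norm (snd p))\<^sup>2)"

definition g_form :: "M \<Rightarrow> M \<Rightarrow> M \<Rightarrow> real" where
  "g_form p a b = h_base p a b - twist p a * twist p b / N_form p"

definition \<sigma>_form :: "M \<Rightarrow> M \<Rightarrow> M \<Rightarrow> real" where
  "\<sigma>_form p a b =
     (norm (fst p) + norm (snd p))
       * (fst a \<bullet> snd b - fst b \<bullet> snd a
          - (d_norm1 p a * d_norm2 p b - d_norm1 p b * d_norm2 p a) / 2)
     + ((d_norm1 p a + d_norm2 p a) * (fst p \<bullet> snd b - snd p \<bullet> fst b)
        - (d_norm1 p b + d_norm2 p b) * (fst p \<bullet> snd a - snd p \<bullet> fst a)) / 2"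

lemma locus_iff: "p \<in> locus \<longleftrightarrow> norm (fst p) > 0 \<and> norm (snd p) > 0"
  by (cases p) (simp add: locus_def)

lemma N_form_pos: assumes "p \<in> locus" shows "N_form p > 0"
proof -
  have "fst p \<bullet> snd p \<le> norm (fst p) * norm (snd p)" by (rule norm_cauchy_schwarz)
  moreover have "norm (fst p) * norm (snd p) > 0" using assms by (simp add: locus_iff)
  ultimately show ?thesis by (simp add: N_form_def)
qed

lemma linear_skew:
  "skew p (a + b) = skew p a + skew p b" "skew p (c *\<^sub>R a) = c *\<^sub>R skew p a"
  by (simp_all add: skew_def algebra_simps)

lemma bilinear_g_form: "bilinear (g_form p)"
  unfolding bilinear_def linear_iff g_form_def h_base_def twist_def d_norm1_def d_norm2_def
    linear_skew
  by (auto simp: inner_simps add_divide_distrib diff_divide_distrib algebra_simps)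

lemma bilinear_\<sigma>_form: "bilinear (\<sigma>_form p)"
  unfolding bilinear_def linear_iff \<sigma>_form_def d_norm1_def d_norm2_def
  by (auto simp: inner_simps add_divide_distrib diff_divide_distrib algebra_simps)

lemma d_norm_dQ:
  assumes "Q x \<in> locus"
  shows "d_norm1 (Q x) (dQ x a) = 2 * z_inner x a" "d_norm2 (Q x) (dQ x a) = 2 * w_inner x a"
  using assms by (simp_all add: d_norm1_def d_norm2_def Q_inner_dQ norm_Q locus_iff)

text \<open>
  The Hopf connection, normalised like \<^const>\<open>\<Theta>\<^sub>2\<close>, which differs from it by the pullback of
  \<open>2 / N * twist\<close>; completing this square produces the last term of \<^const>\<open>g_form\<close>.
\<close>

definition conn :: "R8 \<Rightarrow> R8 \<Rightarrow> real" where
  "conn x a = z_rot x a / z_inner x x + w_rot x a / w_inner x x"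

text \<open>After multiplication by |u|^2 |v|^2 the products expand by
  \<open>\<alpha>\<^sub>2_\<alpha>\<^sub>3_pauli\<close>. The tensor identity handles the base
  terms, the scalar one the fibre terms, the vector one the mixed terms.\<close>

lemma \<alpha>\<^sub>2_\<alpha>\<^sub>3_products:
  assumes "Q x \<in> locus"
  shows "\<alpha>\<^sub>2 x a * \<alpha>\<^sub>2 x b + \<alpha>\<^sub>3 x a * \<alpha>\<^sub>3 x b =
    ((norm (fst (Q x)) * norm (snd (Q x)) - fst (Q x) \<bullet> snd (Q x))
          * (skew (Q x) (dQ x a) \<bullet> skew (Q x) (dQ x b))
        + (skew (Q x) (dQ x a) \<bullet> fst (Q x)) * (skew (Q x) (dQ x b) \<bullet> snd (Q x))
        + (skew (Q x) (dQ x b) \<bullet> fst (Q x)) * (skew (Q x) (dQ x a) \<bullet> snd (Q x)))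
       / (2 * (norm (fst (Q x)))\<^sup>2 * (norm (snd (Q x)))\<^sup>2)
    + (z_inner x x * w_inner x x + fst (Q x) \<bullet> snd (Q x)) / 2 * conn x a * conn x b
    - (conn x a * twist (Q x) (dQ x b) + conn x b * twist (Q x) (dQ x a)) / 2"
proof -
  define u v where "u = z_inner x x" and "v = w_inner x x"
  have pos: "u > 0" "v > 0" using assms by (simp_all add: u_def v_def locus_iff norm_Q)
  define m n k l where "m = skew (Q x) (dQ x a)" and "n = skew (Q x) (dQ x b)"
    and "k = v * z_rot x a + u * w_rot x a" and "l = v * z_rot x b + u * w_rot x b"
  define W where "W = cross3 (fst (Q x)) (snd (Q x))"
  define s t where "s = zw_re x" and "t = zw_im x"
  have c: "conn x a = k / (u * v)" "conn x b = l / (u * v)"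
    using pos by (simp_all add: conn_def k_def l_def u_def[symmetric] v_def[symmetric] field_simps)
  have tw: "twist (Q x) (dQ x a) = (m \<bullet> W) / (u * v)" "twist (Q x) (dQ x b) = (n \<bullet> W) / (u * v)"
    by (simp_all add: twist_def m_def n_def W_def norm_Q u_def v_def)
  have eqs: "u * v * \<alpha>\<^sub>2 x a = m \<bullet> pauli_re x - k * t" "u * v * \<alpha>\<^sub>2 x b = n \<bullet> pauli_re x - l * t"
    "u * v * \<alpha>\<^sub>3 x a = m \<bullet> pauli_im x + k * s" "u * v * \<alpha>\<^sub>3 x b = n \<bullet> pauli_im x + l * s"
    unfolding u_def v_def m_def n_def k_def l_def s_def t_def by (rule \<alpha>\<^sub>2_\<alpha>\<^sub>3_pauli)+
  have st: "2 * (s\<^sup>2 + t\<^sup>2) = u * v + fst (Q x) \<bullet> snd (Q x)"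
    unfolding s_def t_def u_def v_def by (rule fierz_scalar)
  have fv: "2 * (s * (n \<bullet> pauli_im x) - t * (n \<bullet> pauli_re x)) = - (n \<bullet> W)" for n
    unfolding s_def t_def W_def by (rule fierz_vector)
  have "2 * (u * v)\<^sup>2 * (\<alpha>\<^sub>2 x a * \<alpha>\<^sub>2 x b + \<alpha>\<^sub>3 x a * \<alpha>\<^sub>3 x b)
      = 2 * ((u * v * \<alpha>\<^sub>2 x a) * (u * v * \<alpha>\<^sub>2 x b) + (u * v * \<alpha>\<^sub>3 x a) * (u * v * \<alpha>\<^sub>3 x b))"
    by (simp add: algebra_simps power2_eq_square)
  also have "\<dots> = 2 * ((m \<bullet> pauli_re x) * (n \<bullet> pauli_re x) + (m \<bullet> pauli_im x) * (n \<bullet> pauli_im x))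
      + k * l * (2 * (s\<^sup>2 + t\<^sup>2))
      + k * (2 * (s * (n \<bullet> pauli_im x) - t * (n \<bullet> pauli_re x)))
      + l * (2 * (s * (m \<bullet> pauli_im x) - t * (m \<bullet> pauli_re x)))"
    unfolding eqs by (simp add: algebra_simps power2_eq_square)
  finally have prod: "\<alpha>\<^sub>2 x a * \<alpha>\<^sub>2 x b + \<alpha>\<^sub>3 x a * \<alpha>\<^sub>3 x b
      = ((u * v - fst (Q x) \<bullet> snd (Q x)) * (m \<bullet> n)
        + (m \<bullet> fst (Q x)) * (n \<bullet> snd (Q x)) + (n \<bullet> fst (Q x)) * (m \<bullet> snd (Q x))
        + k * l * (u * v + fst (Q x) \<bullet> snd (Q x)) - k * (n \<bullet> W) - l * (m \<bullet> W)) / (2 * (u * v)\<^sup>2)"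
    unfolding st fv fierz_tensor using pos
    by (simp add: field_simps u_def[symmetric] v_def[symmetric])
  show ?thesis
    unfolding prod c tw norm_Q u_def[symmetric] v_def[symmetric] m_def[symmetric] n_def[symmetric]
    using pos by (simp add: field_simps power2_eq_square)
qed

text \<open>The fibre part of 2 R e - 2 \<open>\<alpha>\<^sub>1\<close>^2 is 2 |u| |v| conn^2. The
  forms \<open>\<alpha>\<^sub>2\<close>, \<open>\<alpha>\<^sub>3\<close> take away (|u| |v| + u.v)/2
  of conn^2, which leaves N/4.\<close>

lemma h\<^sub>2_eq:
  assumes "Q x \<in> locus"
  shows "h\<^sub>2 x a b = h_base (Q x) (dQ x a) (dQ x b) + N_form (Q x) / 4 * conn x a * conn x b
    + (conn x a * twist (Q x) (dQ x b) + conn x b * twist (Q x) (dQ x a)) / 2"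
proof -
  define u v where "u = z_inner x x" and "v = w_inner x x"
  have pos: "u > 0" "v > 0" using assms by (simp_all add: u_def v_def locus_iff norm_Q)
  have zi: "z_inner a b = (fst (dQ x a) \<bullet> fst (dQ x b)) / (4 * u) + z_rot x a * z_rot x b / u"
    and wi: "w_inner a b = (snd (dQ x a) \<bullet> snd (dQ x b)) / (4 * v) + w_rot x a * w_rot x b / v"
    unfolding dQ_inner_dQ using pos by (simp_all add: u_def v_def field_simps)
  have c: "conn x a = z_rot x a / u + w_rot x a / v" for a
    by (simp add: conn_def u_def v_def)
  have "h\<^sub>2 x a b = 2 * (x \<bullet> a) * (x \<bullet> b) + 2 * R x * (z_inner a b + w_inner a b)
      - 2 * \<alpha>\<^sub>1 x a * \<alpha>\<^sub>1 x b - (\<alpha>\<^sub>2 x a * \<alpha>\<^sub>2 x b + \<alpha>\<^sub>3 x a * \<alpha>\<^sub>3 x b)"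
    by (simp add: h\<^sub>2_def dR_eq euc_eq_inner inner_split)
  also have "\<dots> = h_base (Q x) (dQ x a) (dQ x b) + N_form (Q x) / 4 * conn x a * conn x b
    + (conn x a * twist (Q x) (dQ x b) + conn x b * twist (Q x) (dQ x a)) / 2"
    unfolding \<alpha>\<^sub>2_\<alpha>\<^sub>3_products[OF assms] h_base_def N_form_def d_norm_dQ[OF assms] norm_Q R_split
      inner_split \<alpha>\<^sub>1_split u_def[symmetric] v_def[symmetric] zi wi c
    using pos by (simp add: field_simps)
  finally show ?thesis .
qed

section \<open>Descent of the metric\<close>

lemma dQ_X: "dQ x (X x) = 0"
  by (simp add: prod_eq_iff vec_eq_iff forall_3 Q_dQ_coords X_coords)

text \<open>\<open>X\<close> turns the phases of z and w in the same sense, \<open>Y\<^sub>1\<close>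
  in opposite senses; the Hopf maps see neither.\<close>

lemma dQ_Y\<^sub>1: "dQ x (Y\<^sub>1 x) = 0"
  by (simp add: prod_eq_iff vec_eq_iff forall_3 Q_dQ_coords Y_coords)

lemma h_form_0: "h_base p 0 b = 0" "twist p 0 = 0"
  by (simp_all add: h_base_def twist_def skew_def d_norm1_def d_norm2_def)

lemma conn_X: "Q x \<in> locus \<Longrightarrow> conn x (X x) = 2"
proof -
  assume "Q x \<in> locus"
  moreover have "z_rot x (X x) = z_inner x x" "w_rot x (X x) = w_inner x x"
    by (simp_all add: zw_defs X_coords)
  ultimately show ?thesis by (simp add: conn_def locus_iff norm_Q)
qed

lemma h\<^sub>2_X:
  assumes "Q x \<in> locus"
  shows "h\<^sub>2 x (X x) a = N_form (Q x) / 2 * conn x a + twist (Q x) (dQ x a)"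
  using assms by (simp add: h\<^sub>2_eq dQ_X h_form_0 conn_X)

lemma N_eq: "Q x \<in> locus \<Longrightarrow> N x = N_form (Q x)"
  by (simp add: N_def h\<^sub>2_X dQ_X h_form_0 conn_X)

lemma h\<^sub>2_descends:
  assumes "Q x \<in> locus"
  shows "h\<^sub>2 x a b = g_form (Q x) (dQ x a) (dQ x b) + 1 / 4 * N x * \<Theta>\<^sub>2 x a * \<Theta>\<^sub>2 x b"
proof -
  have "1 / 4 * N x * \<Theta>\<^sub>2 x a * \<Theta>\<^sub>2 x b = (N_form (Q x) / 2 * conn x a + twist (Q x) (dQ x a))
      * (N_form (Q x) / 2 * conn x b + twist (Q x) (dQ x b)) / N_form (Q x)"
    using N_form_pos[OF assms] unfolding \<Theta>\<^sub>2_def h\<^sub>2_X[OF assms] N_eq[OF assms] by (simp add: field_simps)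
  then show ?thesis
    using N_form_pos[OF assms] unfolding h\<^sub>2_eq[OF assms] g_form_def by (simp add: field_simps)
qed

section \<open>Descent of the contraction of \<phi> with \<open>X\<close>\<close>

lemma \<alpha>_X:
  "\<alpha>\<^sub>1 (X x) a = w_inner x a - z_inner x a"
  "\<alpha>\<^sub>2 x (X x) = - 2 * zw_im x" "\<alpha>\<^sub>3 x (X x) = 2 * zw_re x" "x \<bullet> X x = 0"
  by (simp_all add: zw_defs pauli_defs \<alpha>_coords X_coords)

text \<open>The left side is four times the real part of conj(z* w) (z* dw - (dz)* w), again
  invariant under phases.\<close>

lemma zw_\<alpha>:
  "2 * (2 * zw_im x * \<alpha>\<^sub>3 x a + 2 * zw_re x * \<alpha>\<^sub>2 x a) =
     2 * (z_inner x x * w_inner x a - w_inner x x * z_inner x a)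
     + fst (Q x) \<bullet> snd (dQ x a) - snd (Q x) \<bullet> fst (dQ x a)"
  by (simp add: zw_defs pauli_defs \<alpha>_coords inner_3 Q_dQ_coords algebra_simps power2_eq_square)

text \<open>This is half the exterior derivative of \<open>zw_\<alpha>\<close>: as \<open>X\<close>
  commutes with \<open>Y\<^sub>2\<close> and \<open>Y\<^sub>3\<close>, the forms
  \<open>\<alpha>\<^sub>2 (X x)\<close> and \<open>- \<alpha>\<^sub>3 (X x)\<close> are the
  differentials of \<open>zw_im\<close> and \<open>zw_re\<close>.\<close>

lemma X_contraction:
  "2 * (\<alpha>\<^sub>2 (X x) b * \<alpha>\<^sub>3 x c - \<alpha>\<^sub>2 (X x) c * \<alpha>\<^sub>3 x b + \<alpha>\<^sub>2 b c * (2 * zw_re x)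
      + 2 * zw_im x * \<alpha>\<^sub>3 b c + \<alpha>\<^sub>2 x b * \<alpha>\<^sub>3 (X x) c - \<alpha>\<^sub>2 x c * \<alpha>\<^sub>3 (X x) b)
   = 4 * (z_inner x b * w_inner x c - z_inner x c * w_inner x b)
     + fst (dQ x b) \<bullet> snd (dQ x c) - fst (dQ x c) \<bullet> snd (dQ x b)"
  by (simp add: zw_defs pauli_defs \<alpha>_coords inner_3 Q_dQ_coords X_coords algebra_simps)

lemma \<phi>_descends:
  assumes "Q x \<in> locus"
  shows "\<phi> x (X x) a b = \<sigma>_form (Q x) (dQ x a) (dQ x b)"
proof -
  have "\<phi> x (X x) a b =
     4 * R x * ((x \<bullet> b) * \<alpha>\<^sub>1 (X x) a - (x \<bullet> a) * \<alpha>\<^sub>1 (X x) b)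
     + (x \<bullet> a) * (2 * (2 * zw_im x * \<alpha>\<^sub>3 x b + 2 * zw_re x * \<alpha>\<^sub>2 x b))
     - (x \<bullet> b) * (2 * (2 * zw_im x * \<alpha>\<^sub>3 x a + 2 * zw_re x * \<alpha>\<^sub>2 x a))
     + R x * (2 * (\<alpha>\<^sub>2 (X x) a * \<alpha>\<^sub>3 x b - \<alpha>\<^sub>2 (X x) b * \<alpha>\<^sub>3 x a + \<alpha>\<^sub>2 a b * (2 * zw_re x)
      + 2 * zw_im x * \<alpha>\<^sub>3 a b + \<alpha>\<^sub>2 x a * \<alpha>\<^sub>3 (X x) b - \<alpha>\<^sub>2 x b * \<alpha>\<^sub>3 (X x) a))"
    unfolding \<phi>_eq \<alpha>_X(2-4) by (simp add: algebra_simps)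
  also have "\<dots> = \<sigma>_form (Q x) (dQ x a) (dQ x b)"
    unfolding zw_\<alpha> X_contraction \<alpha>_X(1) \<sigma>_form_def d_norm_dQ[OF assms] norm_Q R_split inner_split
    by (simp add: field_simps)
  finally show ?thesis .
qed

section \<open>Surjectivity of \<open>Q\<close> and of its differential\<close>

lemma hopf_surj:
  fixes A :: "real ^ 3"
  obtains a b c d :: real where "a\<^sup>2 + b\<^sup>2 - c\<^sup>2 - d\<^sup>2 = A $ 1" "2 * (a * c + b * d) = A $ 2"
    "2 * (a * d - b * c) = A $ 3"
proof -
  define r where "r = norm A"
  have r2: "r\<^sup>2 = (A $ 1)\<^sup>2 + (A $ 2)\<^sup>2 + (A $ 3)\<^sup>2"
    unfolding r_def power2_norm_eq_inner by (simp add: inner_3 power2_eq_square)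
  have r1: "\<bar>A $ 1\<bar> \<le> r" unfolding r_def by (rule component_le_norm_cart)
  show thesis
  proof (cases "r + A $ 1 > 0")
    case True
    \<comment> \<open>The phase is fixed by taking the first complex coordinate real and positive;
      its square is then half the sum of |z|^2 = r and \<open>A $ 1\<close>.\<close>
    define a where "a = sqrt ((r + A $ 1) / 2)"
    have a2: "a\<^sup>2 = (r + A $ 1) / 2" and a0: "a \<noteq> 0" using True by (simp_all add: a_def)
    have "((A $ 2)\<^sup>2 + (A $ 3)\<^sup>2) = (r - A $ 1) * (2 * a\<^sup>2)"
      unfolding a2 using r2 by (simp add: algebra_simps power2_eq_square)
    then have "(A $ 2 / (2 * a))\<^sup>2 + (A $ 3 / (2 * a))\<^sup>2 = (r - A $ 1) / 2"
      using a0 by (simp add: field_simps)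
    then have "a\<^sup>2 + 0\<^sup>2 - (A $ 2 / (2 * a))\<^sup>2 - (A $ 3 / (2 * a))\<^sup>2 = A $ 1"
      using a2 by simp
    then show ?thesis
      using a0 by (intro that[of a 0 "A $ 2 / (2 * a)" "A $ 3 / (2 * a)"]) simp_all
  next
    case False
    with r1 have A1: "A $ 1 = - r" by linarith
    with r2 have "(A $ 2)\<^sup>2 + (A $ 3)\<^sup>2 = 0" by simp
    then have "A $ 2 = 0" "A $ 3 = 0" by (simp_all add: sum_power2_eq_zero_iff)
    \<comment> \<open>Over the opposite pole the first complex coordinate vanishes.\<close>
    with A1 r1 show ?thesis by (intro that[of 0 0 "sqrt r" 0]) auto
  qed
qed

lemma Q_surj: obtains x where "Q x = p"
proof -
  obtain a b c d where u: "a\<^sup>2 + b\<^sup>2 - c\<^sup>2 - d\<^sup>2 = fst p $ 1" "2 * (a * c + b * d) = fst p $ 2"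
    "2 * (a * d - b * c) = fst p $ 3" by (rule hopf_surj)
  obtain a' b' c' d' where v: "a'\<^sup>2 + b'\<^sup>2 - c'\<^sup>2 - d'\<^sup>2 = snd p $ 1"
    "2 * (a' * c' + b' * d') = snd p $ 2" "2 * (a' * d' - b' * c') = snd p $ 3" by (rule hopf_surj)
  define x :: R8 where "x = a *\<^sub>R axis 0 1 + b *\<^sub>R axis 1 1 + c *\<^sub>R axis 4 1 + d *\<^sub>R axis 5 1
    + a' *\<^sub>R axis 2 1 + b' *\<^sub>R axis 3 1 + c' *\<^sub>R axis 6 1 + d' *\<^sub>R axis 7 1"
  have [simp]: "x $ 0 = a" "x $ 1 = b" "x $ 4 = c" "x $ 5 = d" "x $ 2 = a'" "x $ 3 = b'"
    "x $ 6 = c'" "x $ 7 = d'" by (simp_all add: x_def axis_def)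
  show thesis
    using u v by (intro that[of x]) (simp add: prod_eq_iff vec_eq_iff forall_3 Q_dQ_coords)
qed

lemma dQ_surj:
  assumes "Q x \<in> locus"
  obtains a where "dQ x a = W"
proof -
  define A B where "A = (1 / (2 * z_inner x x)) *\<^sub>R fst W" and "B = (1 / (2 * w_inner x x)) *\<^sub>R snd W"
  have AB: "fst W = (2 * z_inner x x) *\<^sub>R A" "snd W = (2 * w_inner x x) *\<^sub>R B"
    using assms by (simp_all add: A_def B_def locus_iff norm_Q)
  \<comment> \<open>The witness is ((A.s) z, (B.s) w) with the Pauli matrices s_j: their
    anticommutation relations give 2 Re(z* s_j (A.s) z) = 2 |z|^2 A_j.\<close>
  define a :: R8 where "a =
      (A $ 1 * x $ 0 + A $ 2 * x $ 4 + A $ 3 * x $ 5) *\<^sub>R axis 0 1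
    + (A $ 1 * x $ 1 + A $ 2 * x $ 5 - A $ 3 * x $ 4) *\<^sub>R axis 1 1
    + (A $ 2 * x $ 0 - A $ 3 * x $ 1 - A $ 1 * x $ 4) *\<^sub>R axis 4 1
    + (A $ 2 * x $ 1 + A $ 3 * x $ 0 - A $ 1 * x $ 5) *\<^sub>R axis 5 1
    + (B $ 1 * x $ 2 + B $ 2 * x $ 6 + B $ 3 * x $ 7) *\<^sub>R axis 2 1
    + (B $ 1 * x $ 3 + B $ 2 * x $ 7 - B $ 3 * x $ 6) *\<^sub>R axis 3 1
    + (B $ 2 * x $ 2 - B $ 3 * x $ 3 - B $ 1 * x $ 6) *\<^sub>R axis 6 1
    + (B $ 2 * x $ 3 + B $ 3 * x $ 2 - B $ 1 * x $ 7) *\<^sub>R axis 7 1"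
  have [simp]:
    "a $ 0 = A $ 1 * x $ 0 + A $ 2 * x $ 4 + A $ 3 * x $ 5"
    "a $ 1 = A $ 1 * x $ 1 + A $ 2 * x $ 5 - A $ 3 * x $ 4"
    "a $ 4 = A $ 2 * x $ 0 - A $ 3 * x $ 1 - A $ 1 * x $ 4"
    "a $ 5 = A $ 2 * x $ 1 + A $ 3 * x $ 0 - A $ 1 * x $ 5"
    "a $ 2 = B $ 1 * x $ 2 + B $ 2 * x $ 6 + B $ 3 * x $ 7"
    "a $ 3 = B $ 1 * x $ 3 + B $ 2 * x $ 7 - B $ 3 * x $ 6"
    "a $ 6 = B $ 2 * x $ 2 - B $ 3 * x $ 3 - B $ 1 * x $ 6"
    "a $ 7 = B $ 2 * x $ 3 + B $ 3 * x $ 2 - B $ 1 * x $ 7"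
    by (simp_all add: a_def axis_def)
  show thesis
    by (rule that[of a])
      (simp add: prod_eq_iff vec_eq_iff forall_3 Q_dQ_coords AB zw_defs algebra_simps)
qed

section \<open>The kernel of \<open>h\<^sub>2\<close> and nondegeneracy of the metric\<close>

lemma Y_orthogonal:
  "x \<bullet> Y\<^sub>1 x = 0" "x \<bullet> Y\<^sub>2 x = 0" "x \<bullet> Y\<^sub>3 x = 0"
  "Y\<^sub>1 x \<bullet> Y\<^sub>2 x = 0" "Y\<^sub>1 x \<bullet> Y\<^sub>3 x = 0" "Y\<^sub>2 x \<bullet> Y\<^sub>3 x = 0"
  "Y\<^sub>1 x \<bullet> Y\<^sub>1 x = R x" "Y\<^sub>2 x \<bullet> Y\<^sub>2 x = R x" "Y\<^sub>3 x \<bullet> Y\<^sub>3 x = R x"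
  by (simp_all add: inner_8 Y_coords R_eq_inner)

text \<open>The vectors \<open>x\<close>, \<open>Y\<^sub>1 x\<close>, \<open>Y\<^sub>2 x\<close>,
  \<open>Y\<^sub>3 x\<close> are orthogonal of squared length \<open>R x\<close>, so
  \<open>s\<close> is nonnegative by Bessel's inequality. Then \<open>h\<^sub>2 x a a\<close> is a
  sum of nonnegative terms, and only the \<open>Y\<^sub>1\<close> component escapes it.\<close>

lemma h\<^sub>2_kernel:
  assumes "h\<^sub>2 x a a = 0"
  shows "R x *\<^sub>R a = \<alpha>\<^sub>1 x a *\<^sub>R Y\<^sub>1 x"
proof -
  define r where
    "r = R x *\<^sub>R a - (x \<bullet> a) *\<^sub>R x - \<alpha>\<^sub>1 x a *\<^sub>R Y\<^sub>1 x - \<alpha>\<^sub>2 x a *\<^sub>R Y\<^sub>2 x - \<alpha>\<^sub>3 x a *\<^sub>R Y\<^sub>3 x"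
  define s where "s = R x * (a \<bullet> a) - ((x \<bullet> a)\<^sup>2 + (\<alpha>\<^sub>1 x a)\<^sup>2 + (\<alpha>\<^sub>2 x a)\<^sup>2 + (\<alpha>\<^sub>3 x a)\<^sup>2)"
  have rs: "r \<bullet> r = R x * s"
  proof -
    have a: "a \<bullet> x = x \<bullet> a" "a \<bullet> Y\<^sub>1 x = \<alpha>\<^sub>1 x a" "a \<bullet> Y\<^sub>2 x = \<alpha>\<^sub>2 x a" "a \<bullet> Y\<^sub>3 x = \<alpha>\<^sub>3 x a"
      "Y\<^sub>1 x \<bullet> a = \<alpha>\<^sub>1 x a" "Y\<^sub>2 x \<bullet> a = \<alpha>\<^sub>2 x a" "Y\<^sub>3 x \<bullet> a = \<alpha>\<^sub>3 x a" "x \<bullet> x = R x"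
      by (simp_all add: \<alpha>_eq_inner R_eq_inner inner_commute)
    have y: "Y\<^sub>1 x \<bullet> x = 0" "Y\<^sub>2 x \<bullet> x = 0" "Y\<^sub>3 x \<bullet> x = 0"
      "Y\<^sub>2 x \<bullet> Y\<^sub>1 x = 0" "Y\<^sub>3 x \<bullet> Y\<^sub>1 x = 0" "Y\<^sub>3 x \<bullet> Y\<^sub>2 x = 0"
      using Y_orthogonal(1-6)[of x] by (simp_all add: inner_commute)
    show ?thesis
      unfolding r_def s_def inner_diff_left inner_diff_right inner_scaleR_left inner_scaleR_right
        a y Y_orthogonal
      by (simp add: algebra_simps power2_eq_square)
  qed
  have h: "h\<^sub>2 x a a = 2 * s + (\<alpha>\<^sub>2 x a)\<^sup>2 + (\<alpha>\<^sub>3 x a)\<^sup>2 + 4 * (x \<bullet> a)\<^sup>2"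
    by (simp add: h\<^sub>2_def s_def dR_eq euc_eq_inner algebra_simps power2_eq_square)
  show ?thesis
  proof (cases "x = 0")
    case True
    then show ?thesis by (simp add: R_eq_inner \<alpha>_coords)
  next
    case False
    then have R: "R x > 0" by (simp add: R_eq_inner)
    have "R x * s \<ge> 0" unfolding rs[symmetric] by simp
    with R have s: "s \<ge> 0" by (simp add: zero_le_mult_iff)
    have sq: "(\<alpha>\<^sub>2 x a)\<^sup>2 \<ge> 0" "(\<alpha>\<^sub>3 x a)\<^sup>2 \<ge> 0" "(x \<bullet> a)\<^sup>2 \<ge> 0" by simp_all
    have "s = 0" "(\<alpha>\<^sub>2 x a)\<^sup>2 = 0" "(\<alpha>\<^sub>3 x a)\<^sup>2 = 0" "(x \<bullet> a)\<^sup>2 = 0"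
      using assms s sq unfolding h by linarith+
    then show ?thesis using rs by (simp add: r_def)
  qed
qed

text \<open>A lift \<open>b\<close> of \<open>W\<close> on which \<open>\<Theta>\<^sub>2\<close>
  vanishes has \<open>h\<^sub>2 x b b = g_form p W W = 0\<close>, so it points along
  \<open>Y\<^sub>1\<close>, which \<open>dQ\<close> kills.\<close>

lemma g_form_nondegenerate:
  assumes "p \<in> locus" "\<And>Y. g_form p W Y = 0"
  shows "W = 0"
proof -
  obtain x where x: "Q x = p" by (rule Q_surj)
  with assms have loc: "Q x \<in> locus" by simp
  obtain a where a: "dQ x a = W" using dQ_surj[OF loc] by blast
  have N0: "N x > 0" using N_form_pos[OF loc] by (simp add: N_eq[OF loc])
  \<comment> \<open>The multiple of \<open>X\<close> is the one that makes
    \<open>h\<^sub>2 x (X x) b\<close> zero, given \<open>conn x (X x) = 2\<close>.\<close>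
  define b where "b = a - (conn x a / 2 + twist p W / N x) *\<^sub>R X x"
  have b: "dQ x b = W"
    unfolding b_def by (simp add: linear_diff[OF linear_dQ] linear_cmul[OF linear_dQ] dQ_X a)
  have lin: "conn x (a - c *\<^sub>R X x) = conn x a - 2 * c" for c
  proof -
    have "conn x (a - c *\<^sub>R X x) = conn x a - c * conn x (X x)"
      by (simp add: conn_def zw_defs algebra_simps add_divide_distrib diff_divide_distrib)
    then show ?thesis by (simp add: conn_X[OF loc])
  qed
  have "h\<^sub>2 x (X x) b = N x / 2 * conn x b + twist p W"
    by (simp add: h\<^sub>2_X[OF loc] N_eq[OF loc] b x)
  also have "\<dots> = 0"
    unfolding b_def lin using N0 by (simp add: field_simps)
  finally have "\<Theta>\<^sub>2 x b = 0" by (simp add: \<Theta>\<^sub>2_def)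
  then have "h\<^sub>2 x b b = 0"
    by (simp add: h\<^sub>2_descends[OF loc] b x assms(2))
  then have "R x *\<^sub>R b = \<alpha>\<^sub>1 x b *\<^sub>R Y\<^sub>1 x" by (rule h\<^sub>2_kernel)
  then have "dQ x (R x *\<^sub>R b) = dQ x (\<alpha>\<^sub>1 x b *\<^sub>R Y\<^sub>1 x)" by simp
  then have "R x *\<^sub>R W = 0" by (simp add: linear_cmul[OF linear_dQ] b dQ_Y\<^sub>1)
  moreover have "R x \<noteq> 0" using loc by (simp add: R_split locus_iff norm_Q)
  ultimately show ?thesis by simp
qed

section \<open>Identification of the tensors defined by their pullbacks\<close>

lemma g\<^sub>2_eq:
  assumes "p \<in> locus"
  shows "g\<^sub>2 p = g_form p"
  unfolding g\<^sub>2_def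
proof (rule the_equality)
  show "bilinear (g_form p) \<and> (\<forall>x a b. Q x = p \<longrightarrow>
      h\<^sub>2 x a b = g_form p (dQ x a) (dQ x b) + 1 / 4 * N x * \<Theta>\<^sub>2 x a * \<Theta>\<^sub>2 x b)"
    using assms h\<^sub>2_descends bilinear_g_form by blast
next
  fix g
  assume g: "bilinear g \<and> (\<forall>x a b. Q x = p \<longrightarrow>
      h\<^sub>2 x a b = g (dQ x a) (dQ x b) + 1 / 4 * N x * \<Theta>\<^sub>2 x a * \<Theta>\<^sub>2 x b)"
  obtain x where x: "Q x = p" by (rule Q_surj)
  show "g = g_form p"
  proof (intro ext)
    fix W Y
    \<comment> \<open>One point \<open>x\<close> over \<open>p\<close> suffices for uniqueness,
      since \<open>dQ x\<close> reaches all tangent vectors.\<close>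
    obtain a b where "dQ x a = W" "dQ x b = Y" using assms x dQ_surj by metis
    then show "g W Y = g_form p W Y"
      using g x h\<^sub>2_descends[of x a b] assms by auto
  qed
qed

lemma \<sigma>_eq:
  assumes "p \<in> locus"
  shows "\<sigma> p = \<sigma>_form p"
  unfolding \<sigma>_def
proof (rule the_equality)
  show "bilinear (\<sigma>_form p) \<and> (\<forall>x a b. Q x = p \<longrightarrow>
      \<phi> x (X x) a b = \<sigma>_form p (dQ x a) (dQ x b))"
    using assms \<phi>_descends bilinear_\<sigma>_form by blast
next
  fix s
  assume s: "bilinear s \<and> (\<forall>x a b. Q x = p \<longrightarrow> \<phi> x (X x) a b = s (dQ x a) (dQ x b))"
  obtain x where x: "Q x = p" by (rule Q_surj)
  show "s = \<sigma>_form p"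
  proof (intro ext)
    fix W Y
    obtain a b where "dQ x a = W" "dQ x b = Y" using assms x dQ_surj by metis
    then show "s W Y = \<sigma>_form p W Y"
      using s x \<phi>_descends[of x a b] assms by auto
  qed
qed

lemma N\<^sub>M_eq:
  assumes "p \<in> locus"
  shows "N\<^sub>M p = N_form p"
  unfolding N\<^sub>M_def
proof (rule the_equality)
  show "\<forall>x. Q x = p \<longrightarrow> N x = N_form p" using assms N_eq by blast
  show "c = N_form p" if "\<forall>x. Q x = p \<longrightarrow> N x = c" for c
    using that assms N_eq Q_surj by metis
qed

section \<open>Evaluation of the almost complex structure\<close>

lemma bilinear_represent:
  fixes g s :: "'a :: euclidean_space \<Rightarrow> 'a \<Rightarrow> real"
  assumes g: "bilinear g" and s: "bilinear s" and nondeg: "\<And>w. (\<And>y. g w y = 0) \<Longrightarrow> w = 0"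
  obtains J where "linear J" "\<And>w y. s w y = g (J w) y"
proof -
  \<comment> \<open>\<open>G b w\<close> is the vector dual to \<open>b w\<close> under the inner
    product, so \<open>J\<close> is to be \<open>G s\<close> followed by the inverse of
    \<open>G g\<close>.\<close>
  define G where "G b w = (\<Sum>e\<in>Basis. b w e *\<^sub>R e)" for b :: "'a \<Rightarrow> 'a \<Rightarrow> real" and w
  have G: "G b w \<bullet> y = b w y" if "bilinear b" for b w y
  proof -
    have "linear (b w)" using that by (simp add: bilinear_def)
    then have "b w (\<Sum>e\<in>Basis. (y \<bullet> e) *\<^sub>R e) = (\<Sum>e\<in>Basis. (y \<bullet> e) *\<^sub>R b w e)"
      by (simp add: linear_sum linear_cmul)
    then have "b w y = (\<Sum>e\<in>Basis. (y \<bullet> e) *\<^sub>R b w e)"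
      by (simp only: euclidean_representation)
    then show ?thesis by (simp add: G_def inner_sum_left) (simp add: inner_commute mult.commute)
  qed
  have lin: "linear (G b)" if "bilinear b" for b
  proof (rule linearI)
    show "G b (w + w') = G b w + G b w'" for w w'
      by (rule vector_eq_rdot[THEN iffD1])
        (simp add: G[OF that] inner_add_left bilinear_ladd[OF that])
    show "G b (c *\<^sub>R w) = c *\<^sub>R G b w" for c w
      by (rule vector_eq_rdot[THEN iffD1])
        (simp add: G[OF that] bilinear_lmul[OF that])
  qed
  have "inj (G g)"
    unfolding linear_injective_0[OF lin[OF g]]
    using nondeg G[OF g] by (metis inner_zero_left)
  then obtain H where H: "linear H" "\<forall>x. H (G g x) = x" "\<forall>x. G g (H x) = x"
    using linear_injective_isomorphism[OF lin[OF g]] by blast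
  show thesis
  proof (rule that[of "H \<circ> G s"])
    show "linear (H \<circ> G s)" using lin[OF s] H(1) by (rule linear_compose)
    show "s w y = g ((H \<circ> G s) w) y" for w y
      using G[OF g, of "H (G s w)" y] G[OF s, of w y] H(3) by simp
  qed
qed

text \<open>Nondegeneracy of \<open>g_form\<close> gives both existence and uniqueness in the
  description of \<open>\<J> p\<close>; computing a value is thereby reduced to an identity between
  forms.\<close>

lemma \<J>_eqI:
  assumes p: "p \<in> locus" and W': "\<And>Y. \<sigma>_form p W Y = sqrt (N_form p) * g_form p W' Y"
  shows "\<J> p W = W'"
proof -
  define c where "c = sqrt (N_form p)"
  have c: "c > 0" using N_form_pos[OF p] by (simp add: c_def)
  define B where "B = (\<lambda>w y. c * g_form p w y)"
  have B: "bilinear B"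
    using bilinear_g_form[of p] unfolding B_def bilinear_def linear_iff
    by (simp add: algebra_simps)
  have nd: "w = 0" if "\<And>y. B w y = 0" for w
    using that c by (intro g_form_nondegenerate[OF p]) (simp add: B_def)
  have uniq: "w = w'" if "\<And>y. B w y = B w' y" for w w'
    using nd[of "w - w'"] that by (simp add: bilinear_lsub[OF B])
  obtain J where J: "linear J" "\<And>w y. \<sigma>_form p w y = B (J w) y"
    using bilinear_represent[OF B bilinear_\<sigma>_form nd] by metis
  have "\<J> p = J"
    unfolding \<J>_def
  proof (rule the_equality)
    show "linear J \<and> (\<forall>W Y. \<sigma> p W Y = sqrt (N\<^sub>M p) * g\<^sub>2 p (J W) Y)"
      using J by (simp add: \<sigma>_eq[OF p] N\<^sub>M_eq[OF p] g\<^sub>2_eq[OF p] B_def c_def)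
    fix K assume "linear K \<and> (\<forall>W Y. \<sigma> p W Y = sqrt (N\<^sub>M p) * g\<^sub>2 p (K W) Y)"
    then have "\<sigma>_form p w y = B (K w) y" for w y
      by (simp add: \<sigma>_eq[OF p] N\<^sub>M_eq[OF p] g\<^sub>2_eq[OF p] B_def c_def del: split_paired_All)
    then show "K = J" using uniq J(2) by (metis ext)
  qed
  moreover have "J W = W'"
    using uniq J(2)[of W] W' unfolding B_def c_def by metis
  ultimately show ?thesis by simp
qed

lemma \<J>_scaleR_eqI:
  assumes p: "p \<in> locus" and "\<And>Y. c * \<sigma>_form p W Y = sqrt (N_form p) * g_form p W' Y"
  shows "\<J> p (c *\<^sub>R W) = W'"
  using assms by (intro \<J>_eqI) (auto simp: bilinear_lmul[OF bilinear_\<sigma>_form])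

text \<open>
  The factor \<open>\<surd>N\<close> on the left makes the defining equation of \<^const>\<open>\<J>\<close> free of square roots.
\<close>

lemma \<J>_unit:
  assumes U: "norm U = 1" and V: "norm V = 1"
  shows "\<J> (U, V) (sqrt (N_form (U, V)) *\<^sub>R (U, 0)) =
    (- V - ((1 + U \<bullet> V) / 4) *\<^sub>R U, 3 *\<^sub>R U - ((1 + U \<bullet> V) / 4) *\<^sub>R V)"
proof (rule \<J>_scaleR_eqI)
  show loc: "(U, V) \<in> locus" using assms by (simp add: locus_iff)
  fix Y :: M
  obtain A B where Y: "Y = (A, B)" by (cases Y)
  define c where "c = U \<bullet> V"
  have N: "N_form (U, V) = 6 - 2 * c" using assms by (simp add: N_form_def c_def)
  have UV: "U \<bullet> U = 1" "V \<bullet> V = 1" "U \<bullet> V = c" "V \<bullet> U = c"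
    using assms by (simp_all add: norm_eq_1 c_def inner_commute)
  \<comment> \<open>For the candidate, \<open>skew\<close> lies in the span of \<open>U\<close> and
    \<open>V\<close>, so it is orthogonal to their cross product and the term of
    \<open>g_form\<close> with denominator N drops out.\<close>
  have tw: "twist (U, V) (- V - ((1 + c) / 4) *\<^sub>R U, 3 *\<^sub>R U - ((1 + c) / 4) *\<^sub>R V) = 0"
    by (simp add: twist_def skew_def inner_simps dot_cross_self)
  have "\<sigma>_form (U, V) (U, 0) Y =
      g_form (U, V) (- V - ((1 + c) / 4) *\<^sub>R U, 3 *\<^sub>R U - ((1 + c) / 4) *\<^sub>R V) Y"
    unfolding g_form_def tw \<sigma>_form_def h_base_def d_norm1_def d_norm2_def skew_def Y
    by (simp add: U V UV inner_simps inner_commute[of A] inner_commute[of B])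
      (simp add: field_simps power2_eq_square)
  then show "sqrt (N_form (U, V)) * \<sigma>_form (U, V) (U, 0) Y = sqrt (N_form (U, V)) *
      g_form (U, V) (- V - ((1 + U \<bullet> V) / 4) *\<^sub>R U, 3 *\<^sub>R U - ((1 + U \<bullet> V) / 4) *\<^sub>R V) Y"
    by (simp add: c_def)
qed

text \<open>Lengths are written as squares so that \<surd>N = 2 s t. For parallel u and v the twist
  vanishes, and since \<open>f\<close> is orthogonal to \<open>e\<close> so do the
  \<open>skew\<close> terms.\<close>

lemma \<J>_collinear:
  fixes e f :: "real ^ 3" and s t :: real
  assumes "s > 0" "t > 0" "norm e = 1" "e \<bullet> f = 0"
  shows "\<J> (s\<^sup>2 *\<^sub>R e, t\<^sup>2 *\<^sub>R e) (s *\<^sub>R (f, 0)) = t *\<^sub>R (0, f)"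
proof (rule \<J>_scaleR_eqI)
  show loc: "(s\<^sup>2 *\<^sub>R e, t\<^sup>2 *\<^sub>R e) \<in> locus" using assms by (simp add: locus_iff)
  fix Y :: M
  obtain A B where Y: "Y = (A, B)" by (cases Y)
  have ee: "e \<bullet> e = 1" "f \<bullet> e = 0" "e \<bullet> f = 0"
    using assms by (simp_all add: norm_eq_1 inner_commute)
  have N: "N_form (s\<^sup>2 *\<^sub>R e, t\<^sup>2 *\<^sub>R e) = (2 * s * t)\<^sup>2"
    using assms by (simp add: N_form_def ee power2_eq_square)
  have sq: "sqrt (N_form (s\<^sup>2 *\<^sub>R e, t\<^sup>2 *\<^sub>R e)) = 2 * s * t"
    unfolding N using assms by simp
  show "s * \<sigma>_form (s\<^sup>2 *\<^sub>R e, t\<^sup>2 *\<^sub>R e) (f, 0) Y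
      = sqrt (N_form (s\<^sup>2 *\<^sub>R e, t\<^sup>2 *\<^sub>R e)) * g_form (s\<^sup>2 *\<^sub>R e, t\<^sup>2 *\<^sub>R e) (t *\<^sub>R (0, f)) Y"
    unfolding sq Y g_form_def \<sigma>_form_def h_base_def d_norm1_def d_norm2_def skew_def twist_def
    using assms
    by (simp add: ee inner_simps cross_mult_left cross_mult_right cross_refl)
      (simp add: field_simps power2_eq_square)
qed

section \<open>Non-integrability\<close>

lemma Ck_on_2D:
  assumes "Ck_on 2 S f"
  shows "x \<in> S \<Longrightarrow> f differentiable (at x)"
    and "x \<in> S \<Longrightarrow> (\<lambda>x. frechet_derivative f (at x) v) differentiable (at x)"
    and "continuous_on S (\<lambda>x. frechet_derivative (\<lambda>x. frechet_derivative f (at x) v) (at x) w)"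
  using assms by (simp_all add: numeral_2_eq_2)

lemma differential_injective:
  assumes "open U" "p \<in> U" "\<And>q. q \<in> U \<Longrightarrow> \<eta> (\<psi> q) = q"
    and \<psi>: "\<psi> differentiable (at p)" and \<eta>: "\<eta> differentiable (at (\<psi> p))"
    and 0: "frechet_derivative \<psi> (at p) w = 0"
  shows "w = 0"
proof -
  have "((\<lambda>q. \<eta> (\<psi> q)) has_derivative
      (\<lambda>w. frechet_derivative \<eta> (at (\<psi> p)) (frechet_derivative \<psi> (at p) w))) (at p)"
    using \<psi> \<eta> by (intro has_derivative_compose[of \<psi> _ p UNIV \<eta>])
      (simp_all add: frechet_derivative_works)
  then have "((\<lambda>q. q) has_derivative
      (\<lambda>w. frechet_derivative \<eta> (at (\<psi> p)) (frechet_derivative \<psi> (at p) w))) (at p)"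
    by (rule has_derivative_transform_within_open[OF _ assms(1,2)]) (simp add: assms(3))
  from has_derivative_unique[OF this has_derivative_ident]
  have "w = frechet_derivative \<eta> (at (\<psi> p)) 0" using 0 by metis
  also have "\<dots> = 0" using linear_frechet_derivative[OF \<eta>] by (rule linear_0)
  finally show ?thesis .
qed

text \<open>
  Here \<open>x\<close>, \<open>y\<close> stand for \<open>d\<psi>(f, 0)\<close>, \<open>d\<psi>(0, f)\<close>, and the other unknowns for the second derivatives
  of \<open>\<psi>\<close> in one of the directions \<open>(e, 0)\<close>, \<open>(0, e)\<close> and one of \<open>(f, 0)\<close>, \<open>(0, f)\<close>.
\<close>

lemma complex_linear_system:
  fixes x y H :: "complex" and Hps Hpt Hqs Hqt :: complex
  assumes y: "y = \<i> * x"
    and 1: "- (3 / 2) * Hps + 5 / 2 * Hqs + (- (1 / 2) * x + 3 * y) = \<i> * (2 * Hps + 2 * x)"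
    and 2: "- (3 / 2) * Hpt + 5 / 2 * Hqt + (- x - 1 / 2 * y) = \<i> * (2 * Hpt)"
    and 3: "2 * Hpt = \<i> * (2 * Hps + x)"
    and 4: "2 * Hqt + y = \<i> * (2 * Hqs)"
  shows "x = 0"
proof -
  have i: "\<i> * \<i> = -1" by simp
  have "(1 - 2 * \<i>) * x = 0" using 1 2 3 4 y i by algebra
  moreover have "1 - 2 * \<i> \<noteq> 0" by (simp add: complex_eq_iff)
  ultimately show ?thesis by simp
qed

lemma cart3_basis: "norm (axis 1 1 :: real ^ 3) = 1" "norm (axis 2 1 :: real ^ 3) = 1"
  "(axis 1 1 :: real ^ 3) \<bullet> axis 2 1 = 0" "(axis 2 1 :: real ^ 3) \<bullet> axis 1 1 = 0"
  "(axis 1 1 :: real ^ 3) \<bullet> axis 1 1 = 1" "(axis 2 1 :: real ^ 3) \<bullet> axis 2 1 = 1"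
  by (simp_all add: inner_axis_axis)

theorem corollary7p8:
  shows "\<not> integrable_acs_on locus \<J>"
proof
  assume int: "integrable_acs_on locus \<J>"
  define e f :: "real ^ 3" where "e = axis 1 1" and "f = axis 2 1"
  have ef: "norm e = 1" "norm f = 1" "e \<bullet> f = 0" "f \<bullet> e = 0" "e \<bullet> e = 1" "f \<bullet> f = 1"
    by (simp_all add: e_def f_def cart3_basis)
  define p :: M where "p = (e, e)"
  \<comment> \<open>\<open>P\<close> and \<open>Q'\<close> are the radial directions at
    \<open>p\<close>, \<open>S\<close> and \<open>T\<close> tangential ones; all four curves and
    their fields stay in this span.\<close>
  define P Q' S T :: M where "P = (e, 0)" and "Q' = (0, e)" and "S = (f, 0)" and "T = (0, f)"
  note PQST = P_def Q'_def S_def T_def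
  have "p \<in> locus" by (simp add: p_def locus_iff ef)
  with int obtain U V and \<psi> :: "M \<Rightarrow> complex ^ 3" and \<eta> where
    U: "open U" "p \<in> U" "U \<subseteq> locus" and V: "open V" "\<psi> ` U = V"
    and inv: "\<And>q. q \<in> U \<Longrightarrow> \<eta> (\<psi> q) = q"
    and smooth: "smooth_on U \<psi>" "smooth_on V \<eta>"
    and J: "\<And>q w. q \<in> U \<Longrightarrow>
      frechet_derivative \<psi> (at q) (\<J> q w) = \<i> *s frechet_derivative \<psi> (at q) w"
    unfolding integrable_acs_on_def by (metis (no_types, lifting))
  have C2: "Ck_on 2 U \<psi>" using smooth by (simp add: smooth_on_def)
  define D where "D = frechet_derivative \<psi> (at p)"
  define H where "H v w = frechet_derivative (\<lambda>q. frechet_derivative \<psi> (at q) v) (at p) w" for v w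
  have \<psi>: "\<psi> differentiable (at q)" if "q \<in> U" for q using Ck_on_2D(1)[OF C2 that] .
  have d\<psi>: "(\<lambda>q. frechet_derivative \<psi> (at q) v) differentiable (at q)" if "q \<in> U" for q v
    using Ck_on_2D(2)[OF C2 that] .
  have H_sym: "H v w = H w v" for v w
    unfolding H_def
    by (rule second_derivative_symmetric[OF U(1,2)])
      (use \<psi> d\<psi> Ck_on_2D(3)[OF C2] U in \<open>auto simp: continuous_on_eq_continuous_at\<close>)
  have linD: "linear D" unfolding D_def by (rule linear_frechet_derivative[OF \<psi>[OF U(2)]])
  have linH: "linear (H v)" for v
    unfolding H_def using linear_frechet_derivative[OF d\<psi>[OF U(2)]] by (simp add: eta_contract_eq)
  have linH': "linear (\<lambda>v. H v w)" for w using linH[of w] H_sym by (metis (no_types, lifting) ext)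

  \<comment> \<open>The range \<open>\<bar>t\<bar> < 1\<close> keeps the scale factor 1 + t of the
    last two curves positive.\<close>
  have along: "H (b 0) \<gamma>' + D b' = \<i> *s (H (a 0) \<gamma>' + D a')"
    if \<gamma>: "(\<gamma> has_vector_derivative \<gamma>') (at 0)" "\<gamma> 0 = p"
      and a: "(a has_vector_derivative a') (at 0)" and b: "(b has_vector_derivative b') (at 0)"
      and Jab: "\<And>t :: real. \<bar>t\<bar> < 1 \<Longrightarrow> \<J> (\<gamma> t) (a t) = b t" for \<gamma> \<gamma>' a a' b b'
  proof -
    have *: "((\<lambda>t. frechet_derivative \<psi> (at (\<gamma> t)) (c t)) has_vector_derivative
        H (c 0) \<gamma>' + D c') (at 0)" if "(c has_vector_derivative c') (at 0)" for c c'
      using has_vector_derivative_differential_along_curve[of U \<gamma> \<psi> \<gamma>' c c'] \<gamma> that U \<psi> d\<psi>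
      by (simp add: H_def D_def)
    have "bounded_linear (\<lambda>x :: complex ^ 3. \<i> *s x)"
      by (simp add: linear_conv_bounded_linear[symmetric] linear_iff vec_eq_iff algebra_simps)
    from bounded_linear.has_vector_derivative[OF this *[OF a]]
    have l: "((\<lambda>t. \<i> *s frechet_derivative \<psi> (at (\<gamma> t)) (a t)) has_vector_derivative
        \<i> *s (H (a 0) \<gamma>' + D a')) (at 0)" .
    have "isCont \<gamma> 0" using has_vector_derivative_continuous[OF \<gamma>(1)] .
    then obtain A where A: "open A" "0 \<in> A" "\<And>t. t \<in> A \<Longrightarrow> \<gamma> t \<in> U"
      using U(1,2) \<gamma>(2) unfolding continuous_at_open by metis
    have "((\<lambda>t. \<i> *s frechet_derivative \<psi> (at (\<gamma> t)) (a t)) has_vector_derivative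
        H (b 0) \<gamma>' + D b') (at 0)"
    proof (rule has_vector_derivative_transform_within_open[OF *[OF b]])
      show "open (A \<inter> {-1<..<1})" "0 \<in> A \<inter> {-1<..<1}" using A by auto
      show "frechet_derivative \<psi> (at (\<gamma> t)) (b t) = \<i> *s frechet_derivative \<psi> (at (\<gamma> t)) (a t)"
        if "t \<in> A \<inter> {-1<..<1}" for t
        using J[of "\<gamma> t" "a t"] Jab[of t] A(3)[of t] that by auto
    qed
    with l show ?thesis by (rule vector_derivative_unique_at[rotated])
  qed

  have 0: "D T = \<i> *s D S"
    using J[OF U(2), of S] \<J>_collinear[of 1 1 e f] by (simp add: p_def D_def PQST ef)

  have nrm: "norm (cos t *\<^sub>R e + sin t *\<^sub>R f) = 1" for t
    by (simp add: norm_eq_1 inner_simps ef power2_eq_square[symmetric])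
  \<comment> \<open>This is \<surd>N along both rotations. It is stationary at 0, so only its value
    2 enters.\<close>
  have sN: "((\<lambda>t. sqrt (6 - 2 * cos t)) has_real_derivative 0) (at 0)"
    by (auto intro!: derivative_eq_intros)
  have inn: "(cos t *\<^sub>R e + sin t *\<^sub>R f) \<bullet> e = cos t" "e \<bullet> (cos t *\<^sub>R e + sin t *\<^sub>R f) = cos t" for t
    by (simp_all add: inner_simps ef)
  have Nc: "N_form (cos t *\<^sub>R e + sin t *\<^sub>R f, e) = 6 - 2 * cos t"
    "N_form (e, cos t *\<^sub>R e + sin t *\<^sub>R f) = 6 - 2 * cos t" for t
    by (simp_all add: N_form_def nrm ef inn)
  have curve: "((\<lambda>t. c1 t *\<^sub>R P + c2 t *\<^sub>R Q' + c3 t *\<^sub>R S + c4 t *\<^sub>R T) has_vector_derivative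
      d1 *\<^sub>R P + d2 *\<^sub>R Q' + d3 *\<^sub>R S + d4 *\<^sub>R T) (at 0)"
    if "(c1 has_real_derivative d1) (at 0)" "(c2 has_real_derivative d2) (at 0)"
      "(c3 has_real_derivative d3) (at 0)" "(c4 has_real_derivative d4) (at 0)" for c1 c2 c3 c4 d1 d2 d3 d4
    using that by (auto intro!: derivative_eq_intros)

  have 1: "H ((- 3 / 2) *\<^sub>R P + (5 / 2) *\<^sub>R Q') S + D ((- 1 / 2) *\<^sub>R S + 3 *\<^sub>R T)
      = \<i> *s (H (2 *\<^sub>R P) S + D (2 *\<^sub>R S))"
  proof -
    \<comment> \<open>The first vector rotates from \<open>e\<close> towards \<open>f\<close>; the
      fields are those of \<open>\<J>_unit\<close> with \<open>U\<close> moving.\<close>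
    let ?\<gamma> = "\<lambda>t. cos t *\<^sub>R P + 1 *\<^sub>R Q' + sin t *\<^sub>R S + 0 *\<^sub>R T"
    let ?a = "\<lambda>t. (sqrt (6 - 2 * cos t) * cos t) *\<^sub>R P + 0 *\<^sub>R Q'
      + (sqrt (6 - 2 * cos t) * sin t) *\<^sub>R S + 0 *\<^sub>R T"
    let ?b = "\<lambda>t. (- 1 - (1 + cos t) / 4 * cos t) *\<^sub>R P + (3 * cos t - (1 + cos t) / 4) *\<^sub>R Q'
      + (- ((1 + cos t) / 4 * sin t)) *\<^sub>R S + (3 * sin t) *\<^sub>R T"
    have "(?\<gamma> has_vector_derivative 0 *\<^sub>R P + 0 *\<^sub>R Q' + 1 *\<^sub>R S + 0 *\<^sub>R T) (at 0)"
      "(?a has_vector_derivative 0 *\<^sub>R P + 0 *\<^sub>R Q' + 2 *\<^sub>R S + 0 *\<^sub>R T) (at 0)"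
      "(?b has_vector_derivative 0 *\<^sub>R P + 0 *\<^sub>R Q' + (- 1 / 2) *\<^sub>R S + 3 *\<^sub>R T) (at 0)"
      by (intro curve; (auto intro!: derivative_eq_intros sN)[1])+
    from along[OF this(1) _ this(2,3)] show ?thesis
      using \<J>_unit[OF nrm ef(1)]
      by (simp add: PQST p_def Nc ef algebra_simps linear_0[OF linD, unfolded zero_prod_def])
  qed
  have 2: "H ((- 3 / 2) *\<^sub>R P + (5 / 2) *\<^sub>R Q') T + D (- S + (- 1 / 2) *\<^sub>R T)
      = \<i> *s H (2 *\<^sub>R P) T"
  proof -
    \<comment> \<open>Now the second vector rotates, and (\<open>U\<close>, 0) varies only through
      \<surd>N.\<close>
    let ?\<gamma> = "\<lambda>t. 1 *\<^sub>R P + cos t *\<^sub>R Q' + 0 *\<^sub>R S + sin t *\<^sub>R T"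
    let ?a = "\<lambda>t. sqrt (6 - 2 * cos t) *\<^sub>R P + 0 *\<^sub>R Q' + 0 *\<^sub>R S + 0 *\<^sub>R T"
    let ?b = "\<lambda>t. (- cos t - (1 + cos t) / 4) *\<^sub>R P + (3 - (1 + cos t) / 4 * cos t) *\<^sub>R Q'
      + (- sin t) *\<^sub>R S + (- ((1 + cos t) / 4 * sin t)) *\<^sub>R T"
    have "(?\<gamma> has_vector_derivative 0 *\<^sub>R P + 0 *\<^sub>R Q' + 0 *\<^sub>R S + 1 *\<^sub>R T) (at 0)"
      "(?a has_vector_derivative 0 *\<^sub>R P + 0 *\<^sub>R Q' + 0 *\<^sub>R S + 0 *\<^sub>R T) (at 0)"
      "(?b has_vector_derivative 0 *\<^sub>R P + 0 *\<^sub>R Q' + (- 1) *\<^sub>R S + (- 1 / 2) *\<^sub>R T) (at 0)"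
      by (intro curve; (auto intro!: derivative_eq_intros sN)[1])+
    from along[OF this(1) _ this(2,3)] show ?thesis
      using \<J>_unit[OF ef(1) nrm]
      by (simp add: PQST p_def Nc ef algebra_simps linear_0[OF linD, unfolded zero_prod_def])
  qed
  have 3: "H T (2 *\<^sub>R P) = \<i> *s (H S (2 *\<^sub>R P) + D S)"
  proof -
    \<comment> \<open>The first vector is rescaled, with fields from \<open>\<J>_collinear\<close>;
      the square makes the velocity 2 \<open>P\<close>.\<close>
    let ?\<gamma> = "\<lambda>t. ((1 + t)\<^sup>2) *\<^sub>R P + 1 *\<^sub>R Q' + 0 *\<^sub>R S + 0 *\<^sub>R T"
    let ?a = "\<lambda>t. 0 *\<^sub>R P + 0 *\<^sub>R Q' + (1 + t) *\<^sub>R S + 0 *\<^sub>R T"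
    let ?b = "\<lambda>t. 0 *\<^sub>R P + 0 *\<^sub>R Q' + 0 *\<^sub>R S + 1 *\<^sub>R T"
    have "(?\<gamma> has_vector_derivative 2 *\<^sub>R P + 0 *\<^sub>R Q' + 0 *\<^sub>R S + 0 *\<^sub>R T) (at 0)"
      "(?a has_vector_derivative 0 *\<^sub>R P + 0 *\<^sub>R Q' + 1 *\<^sub>R S + 0 *\<^sub>R T) (at 0)"
      "(?b has_vector_derivative 0 *\<^sub>R P + 0 *\<^sub>R Q' + 0 *\<^sub>R S + 0 *\<^sub>R T) (at 0)"
      by (intro curve; (auto intro!: derivative_eq_intros)[1])+
    from along[OF this(1) _ this(2,3)] show ?thesis
      using \<J>_collinear[of "1 + t" 1 e f for t] ef
      by (simp add: PQST p_def linear_0[OF linD, unfolded zero_prod_def])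
  qed
  have 4: "H T (2 *\<^sub>R Q') + D T = \<i> *s H S (2 *\<^sub>R Q')"
  proof -
    \<comment> \<open>The same with the second vector rescaled.\<close>
    let ?\<gamma> = "\<lambda>t. 1 *\<^sub>R P + ((1 + t)\<^sup>2) *\<^sub>R Q' + 0 *\<^sub>R S + 0 *\<^sub>R T"
    let ?a = "\<lambda>t. 0 *\<^sub>R P + 0 *\<^sub>R Q' + 1 *\<^sub>R S + 0 *\<^sub>R T"
    let ?b = "\<lambda>t. 0 *\<^sub>R P + 0 *\<^sub>R Q' + 0 *\<^sub>R S + (1 + t) *\<^sub>R T"
    have "(?\<gamma> has_vector_derivative 0 *\<^sub>R P + 2 *\<^sub>R Q' + 0 *\<^sub>R S + 0 *\<^sub>R T) (at 0)"
      "(?a has_vector_derivative 0 *\<^sub>R P + 0 *\<^sub>R Q' + 0 *\<^sub>R S + 0 *\<^sub>R T) (at 0)"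
      "(?b has_vector_derivative 0 *\<^sub>R P + 0 *\<^sub>R Q' + 0 *\<^sub>R S + 1 *\<^sub>R T) (at 0)"
      by (intro curve; (auto intro!: derivative_eq_intros)[1])+
    from along[OF this(1) _ this(2,3)] show ?thesis
      using \<J>_collinear[of 1 "1 + t" e f for t] ef
      by (simp add: PQST p_def linear_0[OF linD, unfolded zero_prod_def])
  qed

  note lins = linear_add[OF linD] linear_cmul[OF linD] linear_neg[OF linD]
    linear_add[OF linH] linear_cmul[OF linH] linear_add[OF linH'] linear_cmul[OF linH']
    linear_neg[OF linH'] linear_diff[OF linD] linear_diff[OF linH']
  \<comment> \<open>Symmetry of \<open>H\<close> puts the radial direction first everywhere, so only
    four second derivatives remain, and each complex coordinate satisfies the same system.\<close>
  have "D S $ k = 0" for k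
  proof (rule complex_linear_system)
    show "D T $ k = \<i> * (D S $ k)" using 0 by simp
    show "- (3 / 2) * (H P S $ k) + 5 / 2 * (H Q' S $ k) + (- (1 / 2) * (D S $ k) + 3 * (D T $ k))
        = \<i> * (2 * (H P S $ k) + 2 * (D S $ k))"
      using arg_cong[OF 1, of "\<lambda>x. x $ k"] by (simp add: lins distrib_left scaleR_conv_of_real[where 'a = complex])
    show "- (3 / 2) * (H P T $ k) + 5 / 2 * (H Q' T $ k) + (- (D S $ k) - 1 / 2 * (D T $ k))
        = \<i> * (2 * (H P T $ k))"
      using arg_cong[OF 2, of "\<lambda>x. x $ k"] by (simp add: lins distrib_left scaleR_conv_of_real[where 'a = complex])
    show "2 * (H P T $ k) = \<i> * (2 * (H P S $ k) + D S $ k)"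
      using arg_cong[OF 3, of "\<lambda>x. x $ k"]
      by (simp add: lins distrib_left scaleR_conv_of_real[where 'a = complex] H_sym[of _ P])
    show "2 * (H Q' T $ k) + D T $ k = \<i> * (2 * (H Q' S $ k))"
      using arg_cong[OF 4, of "\<lambda>x. x $ k"]
      by (simp add: lins distrib_left scaleR_conv_of_real[where 'a = complex] H_sym[of _ Q'])
  qed
  then have "D S = 0" by (simp add: vec_eq_iff)
  moreover have "\<eta> differentiable (at (\<psi> p))"
  proof -
    have "Ck_on 2 V \<eta>" using smooth by (simp add: smooth_on_def)
    then show ?thesis using Ck_on_2D(1) V U by blast
  qed
  ultimately have "S = 0"
    using differential_injective[OF U(1,2) inv \<psi>[OF U(2)]] by (simp add: D_def)
  then show False using ef by (simp add: S_def zero_prod_def)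
qed

end
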